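(* Consider the multiple-antenna Rayleigh flat fading channel with coherence time $T=1$, $N$ transmit and $M$ receive antennas, defined by the conditional density (for input $x\in\mathbb{C}^N$, output $y\in\mathbb{C}^M$) $$p(y\mid x)=\frac{\exp\!\big(-\operatorname{tr}\big[(\sigma_Z^2\mathbf{1}_M+(\mathbf{1}_M\otimes x^H)\Sigma(\mathbf{1}_M\otimes x))^{-1}yy^H\big]\big)}{\pi^M\det\big(\sigma_Z^2\mathbf{1}_M+(\mathbf{1}_M\otimes x^H)\Sigma(\mathbf{1}_M\otimes x)\big)},$$ where $\sigma_Z^2>0$ and $\Sigma$ is a Hermitian positive definite $MN\times MN$ matrix. Let $a>0$ and let $\mu_0$ be a capacity-achieving input measure subject to the average power constraint $a$, i.e. $\mu_0$ is a Borel probability measure on $\mathbb{C}^N$ with $\int \frac1N\|x\|^2\,d\mu_0(x)\le a$ and $I(\mu_0;W)=C(a)$. Then $\operatorname{supp}(\mu_0)$ is a bounded subset of $\mathbb{C}^N$.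
   Context: This is the channel $Y=HX+Z$ with $H\in\mathbb{C}^{M\times N}$ complex circularly symmetric Gaussian with zero mean and covariance $\Sigma=\mathbf{E}(H\otimes H^* )$, and $Z$ having i.i.d. $\mathcal{CN}(0,\sigma_Z^2)$ entries, no channel state information at transmitter or receiver. For a Borel probability measure $\mu$ on $\mathbb{C}^N$, $f_\mu(y):=\int p(y\mid x)\,\mu(dx)$ and the mutual information is $I(\mu;W)=\iint p(y\mid x)\log\frac{p(y\mid x)}{f_\mu(y)}\,dy\,d\mu(x)$ (natural logarithm). The capacity is $C(a)=\sup\{I(\mu;W): \mu \text{ a Borel probability measure on } \mathbb{C}^N,\ \int\frac1N\|x\|^2d\mu(x)\le a\}$, and this supremum is attained. $\|x\|^2=\operatorname{tr}(xx^H)=x^Hx$. *)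

theory Defs
  imports "HOL-Probability.Probability"
begin

text \<open>Vectors in C^N: complex^'n; outputs in C^M: complex^'m.
  MN x MN matrices are indexed by 'm \<times> 'n (Kronecker ordering).\<close>

definition cvnorm2 :: "complex^'n \<Rightarrow> real" where
  "cvnorm2 x = (\<Sum>k\<in>UNIV. (cmod (x $ k))\<^sup>2)"

definition hermitian_mat :: "complex^'k^'k \<Rightarrow> bool" where
  "hermitian_mat A \<longleftrightarrow> (\<forall>i j. A $ i $ j = cnj (A $ j $ i))"

definition pos_def_mat :: "complex^'k^'k \<Rightarrow> bool" where
  "pos_def_mat A \<longleftrightarrow> hermitian_mat A \<and>
     (\<forall>v. v \<noteq> 0 \<longrightarrow> Re (\<Sum>i\<in>UNIV. \<Sum>j\<in>UNIV. cnj (v $ i) * A $ i $ j * v $ j) > 0)"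

definition conj_transpose :: "complex^'b^'a \<Rightarrow> complex^'a^'b" where
  "conj_transpose A = (\<chi> i j. cnj (A $ j $ i))"

definition kron_id_col :: "complex^'n \<Rightarrow> complex^'m^('m \<times> 'n)" where
  "kron_id_col x = (\<chi> p j. if fst p = j then x $ snd p else 0)"

definition out_cov :: "real \<Rightarrow> complex^('m \<times> 'n)^('m \<times> 'n) \<Rightarrow> complex^'n \<Rightarrow> complex^'m^'m" where
  "out_cov s2 \<Sigma> x = mat (complex_of_real s2) +
      (conj_transpose (kron_id_col x) ** \<Sigma> ** kron_id_col x)"

definition outer :: "complex^'m \<Rightarrow> complex^'m^'m" where
  "outer y = (\<chi> i j. y $ i * cnj (y $ j))"

definition chan_dens :: "real \<Rightarrow> complex^('m \<times> 'n)^('m \<times> 'n) \<Rightarrow> complex^'n \<Rightarrow> complex^'m \<Rightarrow> real" where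
  "chan_dens s2 \<Sigma> x y =
     exp (- Re (trace (matrix_inv (out_cov s2 \<Sigma> x) ** outer y)))
     / (pi ^ CARD('m) * Re (det (out_cov s2 \<Sigma> x)))"

definition out_dens :: "real \<Rightarrow> complex^('m \<times> 'n)^('m \<times> 'n) \<Rightarrow> (complex^'n) measure \<Rightarrow> complex^'m \<Rightarrow> real" where
  "out_dens s2 \<Sigma> \<mu> y = (\<integral>x. chan_dens s2 \<Sigma> x y \<partial>\<mu>)"

definition mut_info :: "real \<Rightarrow> complex^('m::finite \<times> 'n::finite)^('m \<times> 'n) \<Rightarrow> (complex^'n) measure \<Rightarrow> real" where
  "mut_info s2 \<Sigma> \<mu> =
     (\<integral>x. (\<integral>y. chan_dens s2 \<Sigma> x y * ln (chan_dens s2 \<Sigma> x y / out_dens s2 \<Sigma> \<mu> y) \<partial>(lborel :: (complex^'m) measure)) \<partial>\<mu>)"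

definition admissible :: "real \<Rightarrow> (complex^'n::finite) measure \<Rightarrow> bool" where
  "admissible a \<mu> \<longleftrightarrow> prob_space \<mu> \<and> sets \<mu> = sets borel \<and>
     (\<integral>\<^sup>+ x. ennreal (cvnorm2 x / real CARD('n)) \<partial>\<mu>) \<le> ennreal a"

definition capacity :: "real \<Rightarrow> complex^('m::finite \<times> 'n::finite)^('m \<times> 'n) \<Rightarrow> 'n itself \<Rightarrow> real \<Rightarrow> real" where
  "capacity s2 \<Sigma> _ a = Sup {mut_info s2 \<Sigma> \<mu> | \<mu>. admissible a (\<mu> :: (complex^'n) measure)}"

definition msupp :: "('a::metric_space) measure \<Rightarrow> 'a set" where
  "msupp \<mu> = {x. \<forall>e>0. emeasure \<mu> (ball x e) > 0}"

end

theory Submission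
  imports Defs
begin

text \<open>
  Let \<open>J x\<close> be the relative entropy of \<open>p(y | x)\<close> with respect to the output density \<open>f\<close> of an optimal
  input \<open>\<mu>0\<close>, and let \<open>I\<close> be its mean under \<open>\<mu>0\<close>, i.e. the capacity. Perturbing \<open>\<mu>0\<close> towards an admissible
  \<open>\<mu>1\<close> shows that the mean of \<open>J\<close> under \<open>\<mu>1\<close> is at most \<open>I\<close>. On the other hand \<open>J\<close> is unbounded, so \<open>J z > I\<close>
  for some \<open>z\<close>. If the support of \<open>\<mu>0\<close> were unbounded, the tail of \<open>f\<close> would be heavier than every Gaussian,
  whence \<open>J x\<close> would be \<open>o(|x|\<^sup>2)\<close>. Then moving the mass of a far region of the support to the origin loses
  little of the mean of \<open>J\<close> and saves enough power to place mass at \<open>z\<close> with a net gain, a contradiction.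

  Only two-sided Gaussian bounds on \<open>p(y | x)\<close> enter this argument. They follow from bounds on the
  quadratic form of the output covariance; the bounds on its determinant are obtained by comparing
  Gaussian integrals.
\<close>

section \<open>Mixtures of two probability measures\<close>

text \<open>The power constraint shapes the argument: mass cannot simply be moved to
  \<open>z\<close>, because that may cost power. What decides is an exchange rate. Mass far out
  yields at most \<delta> units of \<open>J\<close> per unit of power, with \<delta> as small as
  desired, whereas mass at \<open>z\<close> yields the fixed surplus \<open>J z - I\<close> for a
  fixed amount of power. Buying the second with power saved on the first stays admissible, so no
  Lagrange multiplier appears. Unbounded support is used twice: for the slow growth of
  \<open>J\<close>, and to dominate the output density of the modified input by a multiple of
  \<open>f\<close>. Without the heavy tail, \<open>f\<close> could decay faster than the density of
  the output given \<open>z\<close>, and the first-order condition would not apply. Mutual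
  information is a Bochner integral and capacity a real \<open>Sup\<close>. Hence integrability of
  the divergences and an upper bound on the achievable values must be proved before optimality
  becomes an inequality.\<close>

definition mix :: "real \<Rightarrow> 'a measure \<Rightarrow> 'a measure \<Rightarrow> 'a measure" where
  "mix \<theta> \<mu> \<nu> = measure_pmf (bernoulli_pmf \<theta>) \<bind> (\<lambda>b. if b then \<nu> else \<mu>)"

context
  fixes \<theta> :: real and \<mu> \<nu> :: "'a measure" and N :: "'a measure"
  assumes \<theta>: "0 \<le> \<theta>" "\<theta> \<le> 1"
    and \<mu>: "\<mu> \<in> space (prob_algebra N)" and \<nu>: "\<nu> \<in> space (prob_algebra N)"
begin

lemma mix_in_prob_algebra: "mix \<theta> \<mu> \<nu> \<in> space (prob_algebra N)"
proof -
  have K: "(\<lambda>b. if b then \<nu> else \<mu>) \<in> measure_pmf (bernoulli_pmf \<theta>) \<rightarrow>\<^sub>M subprob_algebra N"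
    using \<mu> \<nu> by (auto simp: measurable_def space_prob_algebra space_subprob_algebra prob_space_imp_subprob_space)
  have "prob_space (mix \<theta> \<mu> \<nu>)"
    unfolding mix_def
    by (rule measure_pmf.prob_space_bind[OF _ K]) (use \<mu> \<nu> in \<open>auto simp: space_prob_algebra\<close>)
  moreover have "sets (mix \<theta> \<mu> \<nu>) = sets N"
    unfolding mix_def using \<mu> \<nu> by (subst sets_bind[where N=N]) (auto simp: space_prob_algebra)
  ultimately show ?thesis by (simp add: space_prob_algebra)
qed

text \<open>The encoding by \<open>bind\<close> pays here: integrating against a bind is iterated
  integration, and the outer measure has two atoms.\<close>

lemma nn_integral_mix:
  assumes h: "h \<in> borel_measurable N"
  shows "(\<integral>\<^sup>+x. h x \<partial>mix \<theta> \<mu> \<nu>) = ennreal (1 - \<theta>) * (\<integral>\<^sup>+x. h x \<partial>\<mu>) + ennreal \<theta> * (\<integral>\<^sup>+x. h x \<partial>\<nu>)"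
proof -
  have K: "(\<lambda>b. if b then \<nu> else \<mu>) \<in> measure_pmf (bernoulli_pmf \<theta>) \<rightarrow>\<^sub>M subprob_algebra N"
    using \<mu> \<nu> by (auto simp: measurable_def space_prob_algebra space_subprob_algebra prob_space_imp_subprob_space)
  show ?thesis
    unfolding mix_def nn_integral_bind[OF h K]
    using \<theta> by (simp add: nn_integral_measure_pmf nn_integral_count_space_finite UNIV_bool ac_simps)
qed

text \<open>Nonnegativity reduces this to the previous lemma. It covers every later integrand: the
  density \<open>p\<close>, the squared norm and the divergence \<open>J\<close>.\<close>

lemma has_bochner_integral_mix:
  fixes h :: "'a \<Rightarrow> real"
  assumes nn: "\<And>x. h x \<ge> 0" and h: "integrable \<mu> h" "integrable \<nu> h"
  shows "has_bochner_integral (mix \<theta> \<mu> \<nu>) h ((1 - \<theta>) * (\<integral>x. h x \<partial>\<mu>) + \<theta> * (\<integral>x. h x \<partial>\<nu>))"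
proof (rule has_bochner_integral_nn_integral)
  have m: "h \<in> borel_measurable N"
    using borel_measurable_integrable[OF h(1)] \<mu> measurable_cong_sets[of \<mu> N borel borel]
    by (auto simp: space_prob_algebra)
  then show "h \<in> borel_measurable (mix \<theta> \<mu> \<nu>)"
    using mix_in_prob_algebra measurable_cong_sets[of "mix \<theta> \<mu> \<nu>" N borel borel] by (auto simp: space_prob_algebra)
  have I: "0 \<le> (\<integral>x. h x \<partial>\<mu>)" "0 \<le> (\<integral>x. h x \<partial>\<nu>)" using nn by auto
  show "(\<integral>\<^sup>+x. h x \<partial>mix \<theta> \<mu> \<nu>) = ennreal ((1 - \<theta>) * (\<integral>x. h x \<partial>\<mu>) + \<theta> * (\<integral>x. h x \<partial>\<nu>))"
    using \<theta> m I nn h by (subst nn_integral_mix) (auto simp: nn_integral_eq_integral ennreal_plus ennreal_mult)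
  show "0 \<le> (1 - \<theta>) * (\<integral>x. h x \<partial>\<mu>) + \<theta> * (\<integral>x. h x \<partial>\<nu>)" using \<theta> I by simp
qed (auto simp: nn)

end

section \<open>Channels with Gaussian bounds\<close>

text \<open>For the fading channel \<open>s\<close> is the noise variance, \<open>l\<close> and
  \<open>k\<close> bound the quadratic form of \<open>\<Sigma>\<close> on unit vectors, and
  \<open>c\<close> is \<open>1 / pi ^ M\<close>. The lower bound on \<open>p\<close> pairs the
  smallest variance in the exponent with the largest determinant, the upper bound does the converse.
  \<open>gauss_integral\<close> makes \<open>M\<close> the complex dimension of the output.\<close>

locale gaussian_channel =
  fixes p :: "'a::euclidean_space \<Rightarrow> 'b::euclidean_space \<Rightarrow> real"
    and s l k c :: real and M :: nat
  assumes p_measurable_pair: "case_prod p \<in> borel_measurable (borel \<Otimes>\<^sub>M borel)"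
    and p_integral: "has_bochner_integral lborel (p x) 1"
    and p_lower: "c * exp (- ((norm y)\<^sup>2 / (s + l * (norm x)\<^sup>2))) / (s + k * (norm x)\<^sup>2) ^ M \<le> p x y"
    and p_upper: "p x y \<le> c * exp (- ((norm y)\<^sup>2 / (s + k * (norm x)\<^sup>2))) / (s + l * (norm x)\<^sup>2) ^ M"
    and gauss_integral: "\<beta> > 0 \<Longrightarrow> has_bochner_integral lborel (\<lambda>y::'b. exp (- ((norm y)\<^sup>2 / \<beta>))) (\<beta> ^ M / c)"
    and params: "s > 0" "l > 0" "l \<le> k" "c > 0" "M > 0"
begin

section \<open>Logarithm and second moment of the channel density\<close>

lemma k_pos: "k > 0" using params by linarith

lemma alpha_pos: "s + l * (norm (x::'a))\<^sup>2 > 0" "s + k * (norm x)\<^sup>2 > 0"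
  using params k_pos by (auto intro: add_pos_nonneg)

lemma alpha_ge: "s \<le> s + l * (norm (x::'a))\<^sup>2" "s \<le> s + k * (norm x)\<^sup>2"
    "s + l * (norm x)\<^sup>2 \<le> s + k * (norm x)\<^sup>2" "s + k * (norm x)\<^sup>2 \<le> k / l * (s + l * (norm x)\<^sup>2)"
proof -
  show "s + k * (norm x)\<^sup>2 \<le> k / l * (s + l * (norm x)\<^sup>2)"
    using params mult_left_mono[of l k s] by (simp add: field_simps)
qed (use params k_pos in \<open>auto intro: mult_right_mono\<close>)

lemma measurable_p [measurable (raw)]:
  assumes [measurable]: "g \<in> borel_measurable N" "h \<in> borel_measurable N"
  shows "(\<lambda>w. p (g w) (h w)) \<in> borel_measurable N"
  using measurable_compose[OF measurable_Pair[OF assms] p_measurable_pair] by simp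

lemma p_pos: "p x y > 0"
  by (rule less_le_trans[OF _ p_lower]) (use params alpha_pos in auto)

lemma p_le: "p x y \<le> c / s ^ M"
proof -
  have "c * exp (- ((norm y)\<^sup>2 / (s + k * (norm x)\<^sup>2))) / (s + l * (norm x)\<^sup>2) ^ M \<le> c * 1 / s ^ M"
    using params alpha_pos[of x] alpha_ge[of x] by (intro frac_le mult_left_mono power_mono) auto
  with p_upper[of x y] show ?thesis by simp
qed

lemma integrable_p: "integrable lborel (p x)" and integral_p: "(\<integral>y. p x y \<partial>lborel) = 1"
  using p_integral[of x] by (auto simp: has_bochner_integral_iff)

definition B :: real where "B = \<bar>ln c\<bar> + \<bar>ln (c / s ^ M)\<bar> + M * s + M * k + 1 / s"

lemma B_pos: "B > 0" unfolding B_def using params k_pos by (intro add_nonneg_pos add_nonneg_nonneg) auto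

text \<open>Quadratic growth is enough because second moments are finite, so the logarithm of the
  determinant factor may be estimated crudely by \<open>ln u \<le> u - 1\<close>.\<close>

lemma ln_p_bound: "\<bar>ln (p x y)\<bar> \<le> B * (1 + (norm x)\<^sup>2 + (norm y)\<^sup>2)"
proof -
  let ?b = "s + k * (norm x)\<^sup>2" and ?a = "s + l * (norm x)\<^sup>2"
  have up: "ln (p x y) \<le> ln (c / s ^ M)" using p_pos[of x y] p_le[of x y] by simp
  have "ln (c * exp (- ((norm y)\<^sup>2 / ?a)) / ?b ^ M) \<le> ln (p x y)"
    using params alpha_pos[of x] p_lower by (subst ln_le_cancel_iff) (auto simp: p_pos)
  then have lo: "ln c - (norm y)\<^sup>2 / ?a - M * ln ?b \<le> ln (p x y)"
    using params alpha_pos[of x] by (simp add: ln_div ln_mult ln_realpow)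
  have "M * ln ?b \<le> M * ?b"
    using ln_le_minus_one[of ?b] alpha_pos[of x] by (intro mult_left_mono) auto
  moreover have "(norm y)\<^sup>2 / ?a \<le> (norm y)\<^sup>2 / s"
    using params alpha_ge[of x] by (intro divide_left_mono) (auto simp: alpha_pos)
  ultimately have 1: "\<bar>ln (p x y)\<bar> \<le> \<bar>ln c\<bar> + \<bar>ln (c / s ^ M)\<bar> + M * s + (M * k) * (norm x)\<^sup>2 + (1/s) * (norm y)\<^sup>2"
    using lo up params k_pos by (simp add: algebra_simps)
      (smt (verit, ccfv_threshold) mult_nonneg_nonneg of_nat_0_le_iff zero_le_power2 divide_nonneg_pos)
  have 2: "\<dots> \<le> B * 1 + B * (norm x)\<^sup>2 + B * (norm y)\<^sup>2"
    unfolding B_def using params k_pos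
    by (intro add_mono mult_right_mono) auto
  with 1 show ?thesis by (simp add: algebra_simps)
qed

text \<open>The factor \<open>2\<close> comes from a Gaussian of doubled variance,
  \<open>k / l\<close> from the ratio of the two variance scales, and \<open>s + k\<close> from
  \<open>s + k * t \<le> (s + k) * (1 + t)\<close>.\<close>

definition V :: real where "V = (2 * k / l) ^ M * (s + k)"

lemma V_pos: "V > 0" unfolding V_def using params k_pos by auto

text \<open>The factor |y|^2 is absorbed by doubling the variance of the upper Gaussian, whose
  integral is known. The ratio of the two variance scales stays below \<open>k / l\<close> for all
  \<open>x\<close>, so the result grows only like |x|^2.\<close>

lemma second_moment:
  shows integrable_p_norm2: "integrable lborel (\<lambda>y. p x y * (norm y)\<^sup>2)" (is ?A)
    and integral_p_norm2: "(\<integral>y. p x y * (norm y)\<^sup>2 \<partial>lborel) \<le> V * (1 + (norm x)\<^sup>2)" (is ?B)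
proof -
  let ?b = "s + k * (norm x)\<^sup>2" and ?a = "s + l * (norm x)\<^sup>2"
  have pos: "?a > 0" "?b > 0" by (rule alpha_pos)+
  let ?g = "\<lambda>y::'b. (c * ?b / ?a ^ M) * exp (- ((norm y)\<^sup>2 / (2 * ?b)))"
  have g: "has_bochner_integral lborel ?g ((c * ?b / ?a ^ M) * ((2 * ?b) ^ M / c))"
    using pos by (intro has_bochner_integral_mult_right gauss_integral) simp
  have le: "p x y * (norm y)\<^sup>2 \<le> ?g y" for y
  proof -
    let ?u = "(norm y)\<^sup>2 / ?b"
    have e1: "u * exp (- u) \<le> exp (- (u / 2))" if "u \<ge> 0" for u :: real
    proof -
      \<comment> \<open>The difference of the two sides is half of
        \<open>(u / 2 - 1)\<^sup>2\<close> plus one half.\<close>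
      have "u \<le> 1 + u / 2 + (u / 2)\<^sup>2 / 2"
        using zero_le_power2[of "u / 2 - 1"] by (simp add: power2_eq_square algebra_simps)
      also have "\<dots> \<le> exp (u / 2)" using exp_lower_Taylor_quadratic[of "u / 2"] that by simp
      finally have "u * exp (- u) \<le> exp (u / 2) * exp (- u)" by (intro mult_right_mono) auto
      then show ?thesis by (simp flip: exp_add)
    qed
    have "?u * exp (- ?u) \<le> exp (- (?u / 2))" by (rule e1) (use pos in auto)
    then have u: "?u * exp (- ?u) \<le> exp (- ((norm y)\<^sup>2 / (2 * ?b)))"
      by (simp only: divide_divide_eq_left mult.commute)
    have "p x y * (norm y)\<^sup>2 \<le> (c * exp (- ?u) / ?a ^ M) * (norm y)\<^sup>2"
      by (intro mult_right_mono p_upper) auto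
    also have "\<dots> = (c * ?b / ?a ^ M) * (?u * exp (- ?u))"
    proof -
      have "c * E / a * Y = (c * b / a) * (Y / b * E)" if "b \<noteq> 0" for E a Y b :: real
        using that by simp
      then show ?thesis using pos by auto
    qed
    also have "\<dots> \<le> ?g y" using u params pos by (intro mult_left_mono) auto
    finally show ?thesis .
  qed
  show A: ?A
  proof (rule Bochner_Integration.integrable_bound)
    show "integrable lborel ?g" using g by (simp only: has_bochner_integral_iff)
    have "norm (p x y * (norm y)\<^sup>2) \<le> norm (?g y)" for y
      using order_trans[OF le abs_ge_self] p_pos[of x y] by (simp only: real_norm_def abs_mult) auto
    then show "AE y in lborel. norm (p x y * (norm y)\<^sup>2) \<le> norm (?g y)" by simp
  qed simp
  have "(\<integral>y. p x y * (norm y)\<^sup>2 \<partial>lborel) \<le> (\<integral>y. ?g y \<partial>lborel)"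
    using g by (intro integral_mono A le) (auto simp: has_bochner_integral_iff)
  also have "\<dots> = (c * ?b / ?a ^ M) * ((2 * ?b) ^ M / c)" using g by (simp add: has_bochner_integral_iff)
  also have "\<dots> = ((2 * ?b) / ?a) ^ M * ?b" using params by (simp add: power_divide)
  also have "\<dots> \<le> (2 * k / l) ^ M * ((s + k) * (1 + (norm x)\<^sup>2))"
  proof (intro mult_mono power_mono)
    have "2 * ?b / ?a \<le> 2 * (k / l * ?a) / ?a"
      using pos alpha_ge(4)[of x] by (intro divide_right_mono mult_left_mono) auto
    then show "2 * ?b / ?a \<le> 2 * k / l" using pos by simp
    show "?b \<le> (s + k) * (1 + (norm x)\<^sup>2)" using params k_pos by (simp add: algebra_simps)
  qed (use pos params k_pos in auto)
  finally show ?B unfolding V_def by (simp add: mult.assoc)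
qed

text \<open>The second bound keeps track of \<open>x\<close>: being quadratic, it is integrable
  under every input of finite power, which is what Fubini needs in
  \<open>golden_formula\<close>.\<close>

lemma integrable_p_times:
  fixes g :: "'b \<Rightarrow> real"
  assumes [measurable]: "g \<in> borel_measurable borel" and "\<And>y. \<bar>g y\<bar> \<le> C * (1 + (norm y)\<^sup>2)"
  shows "integrable lborel (\<lambda>y. p x y * g y)"
    and "(\<integral>y. \<bar>p x y * g y\<bar> \<partial>lborel) \<le> C * (1 + V) * (1 + (norm x)\<^sup>2)"
proof -
  have C: "C \<ge> 0" using assms(2)[of 0] by simp
  let ?h = "\<lambda>y. C * (p x y + p x y * (norm y)\<^sup>2)"
  have h: "integrable lborel ?h" using integrable_p integrable_p_norm2 by auto
  have b: "\<bar>p x y * g y\<bar> \<le> ?h y" for y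
    using mult_left_mono[OF assms(2)[of y] less_imp_le[OF p_pos[of x y]]] p_pos[of x y]
    by (simp add: abs_mult algebra_simps)
  show I: "integrable lborel (\<lambda>y. p x y * g y)"
    by (rule Bochner_Integration.integrable_bound[OF h]) (auto intro: order_trans[OF b abs_ge_self])
  have "(\<integral>y. \<bar>p x y * g y\<bar> \<partial>lborel) \<le> (\<integral>y. ?h y \<partial>lborel)"
    using I h b by (intro integral_mono) auto
  also have "\<dots> = C * (1 + (\<integral>y. p x y * (norm y)\<^sup>2 \<partial>lborel))"
    using integrable_p integrable_p_norm2 by (simp add: integral_p)
  also have "\<dots> \<le> C * (1 + V * (1 + (norm x)\<^sup>2))" using C by (intro mult_left_mono add_left_mono integral_p_norm2)
  also have "\<dots> \<le> C * ((1 + V) * (1 + (norm x)\<^sup>2))" using C V_pos by (intro mult_left_mono) (auto simp: algebra_simps)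
  finally show "(\<integral>y. \<bar>p x y * g y\<bar> \<partial>lborel) \<le> C * (1 + V) * (1 + (norm x)\<^sup>2)" by (simp add: mult.assoc)
qed

lemma measurable_p_times:
  fixes g :: "'b \<Rightarrow> real"
  assumes g [measurable]: "g \<in> borel_measurable borel" and [measurable_cong]: "sets \<nu> = sets borel"
  shows "(\<lambda>(x, y). p x y * g y) \<in> borel_measurable (\<nu> \<Otimes>\<^sub>M lborel)"
    and "(\<lambda>x. \<integral>y. \<bar>p x y * g y\<bar> \<partial>lborel) \<in> borel_measurable \<nu>"
  by measurable

text \<open>\<open>f \<nu>\<close> is the output density for the input \<open>\<nu>\<close>, and \<open>J \<nu> x\<close> is the relative entropy of the law of the
  output given \<open>x\<close> with respect to \<open>f \<nu>\<close>; the mutual information of \<open>\<mu>\<close> is the mean of \<open>J \<mu>\<close> under \<open>\<mu>\<close>.\<close>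

definition f :: "'a measure \<Rightarrow> 'b \<Rightarrow> real" where "f \<nu> y = (\<integral>x. p x y \<partial>\<nu>)"

definition J :: "'a measure \<Rightarrow> 'a \<Rightarrow> real" where
  "J \<nu> x = (\<integral>y. p x y * ln (p x y / f \<nu> y) \<partial>lborel)"

end

lemma prob_algebra_borelD:
  assumes "\<nu> \<in> space (prob_algebra borel)"
  shows "prob_space \<nu>" "sets \<nu> = sets borel" "space \<nu> = UNIV"
  using assms sets_eq_imp_space_eq[of \<nu> borel] by (auto simp: space_prob_algebra)

context gaussian_channel
begin

section \<open>Output density and relative entropy\<close>

context
  fixes \<nu> :: "'a measure" assumes \<nu>: "\<nu> \<in> space (prob_algebra borel)"
begin

interpretation prob_space \<nu> by (rule prob_algebra_borelD[OF \<nu>])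

lemma sets_nu [measurable_cong]: "sets \<nu> = sets borel" by (rule prob_algebra_borelD[OF \<nu>])

lemma space_nu: "space \<nu> = UNIV" by (rule prob_algebra_borelD[OF \<nu>])

lemma f_measurable [measurable]: "f \<nu> \<in> borel_measurable borel"
  unfolding f_def by measurable

lemma integrable_p_input: "integrable \<nu> (\<lambda>x. p x y)"
  by (rule integrable_const_bound[where B="c / s ^ M"]) (use p_le p_pos in \<open>auto simp: less_imp_le\<close>)

lemma f_le: "f \<nu> y \<le> c / s ^ M"
  unfolding f_def by (rule integral_le_const[OF integrable_p_input]) (auto simp: p_le)

lemma nn_integral_p_input: "(\<integral>\<^sup>+x. p x y \<partial>\<nu>) = f \<nu> y"
  unfolding f_def by (rule nn_integral_eq_integral[OF integrable_p_input]) (auto simp: less_imp_le p_pos)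

text \<open>Only the inputs in \<open>A\<close> are kept; the inner radius controls the exponent and
  the outer one the determinant. With \<open>r = 0\<close> this gives positivity of
  \<open>f \<nu>\<close> and the growth of its logarithm, with large \<open>r\<close> the slow decay
  of its tail.\<close>

lemma f_lower:
  assumes A: "A \<in> sets borel" "\<And>x. x \<in> A \<Longrightarrow> r \<le> norm x \<and> norm x \<le> R" and r: "r \<ge> 0"
  shows "measure \<nu> A * (c * exp (- ((norm y)\<^sup>2 / (s + l * r\<^sup>2))) / (s + k * R\<^sup>2) ^ M) \<le> f \<nu> y"
proof -
  let ?K = "c * exp (- ((norm y)\<^sup>2 / (s + l * r\<^sup>2))) / (s + k * R\<^sup>2) ^ M"
  have A': "A \<in> sets \<nu>" using A by (simp add: sets_nu)
  have "?K \<le> p x y" if "x \<in> A" for x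
  proof (rule order_trans[OF _ p_lower])
    have 1: "r\<^sup>2 \<le> (norm x)\<^sup>2" "(norm x)\<^sup>2 \<le> R\<^sup>2" using A(2)[OF that] r by (auto intro!: power_mono)
    have sl: "s + l * r\<^sup>2 > 0" using params by (auto intro: add_pos_nonneg)
    show "?K \<le> c * exp (- ((norm y)\<^sup>2 / (s + l * (norm x)\<^sup>2))) / (s + k * (norm x)\<^sup>2) ^ M"
      using 1 params k_pos sl alpha_pos[of x]
      by (intro frac_le mult_left_mono power_mono) (auto intro!: divide_left_mono mult_left_mono)
  qed
  moreover have "integrable \<nu> (\<lambda>x. indicator A x * ?K)"
    by (rule integrable_mult_left) (use A' in \<open>auto simp: emeasure_eq_measure\<close>)
  ultimately have "(\<integral>x. indicator A x * ?K \<partial>\<nu>) \<le> (\<integral>x. p x y \<partial>\<nu>)"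
    by (intro integral_mono integrable_p_input) (auto split: split_indicator simp: less_imp_le p_pos)
  then show ?thesis using A' by (simp add: f_def)
qed

lemma exists_bounded_mass: "\<exists>R. measure \<nu> (cball 0 R) > 0"
proof (rule ccontr)
  assume "\<nexists>R. measure \<nu> (cball 0 R) > 0"
  then have 0: "emeasure \<nu> (cball 0 R) = 0" for R
    by (simp add: emeasure_eq_measure) (metis measure_nonneg order_le_less)
  have "emeasure \<nu> (\<Union>n::nat. cball 0 (real n)) = 0"
    by (rule emeasure_UN_eq_0) (auto simp: 0 sets_nu)
  moreover have "(\<Union>n::nat. cball (0::'a) (real n)) = UNIV"
    by (auto simp: real_arch_simple)
  ultimately show False using emeasure_space_1 by (simp add: space_nu)
qed

lemma f_bounds: "\<exists>C\<ge>0. \<forall>y. f \<nu> y > 0 \<and> \<bar>ln (f \<nu> y)\<bar> \<le> C * (1 + (norm y)\<^sup>2)"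
proof -
  obtain R where R: "measure \<nu> (cball 0 R) > 0" using exists_bounded_mass by blast
  define d where "d = measure \<nu> (cball 0 R) * c / (s + k * R\<^sup>2) ^ M"
  have "s + k * R\<^sup>2 > 0" using params k_pos by (auto intro: add_pos_nonneg)
  then have d: "d > 0" unfolding d_def using R params by simp
  have lo: "d * exp (- ((norm y)\<^sup>2 / s)) \<le> f \<nu> y" for y
    using f_lower[of "cball 0 R" 0 R y] by (simp add: d_def)
  have pos: "f \<nu> y > 0" for y using lo[of y] d by (smt (verit) exp_gt_zero mult_pos_pos)
  let ?C = "\<bar>ln d\<bar> + \<bar>ln (c / s ^ M)\<bar> + 1 / s"
  have "\<bar>ln (f \<nu> y)\<bar> \<le> ?C * (1 + (norm y)\<^sup>2)" for y
  proof -
    have "ln (d * exp (- ((norm y)\<^sup>2 / s))) \<le> ln (f \<nu> y)" using lo[of y] d pos by (subst ln_le_cancel_iff) auto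
    then have "ln d - (norm y)\<^sup>2 / s \<le> ln (f \<nu> y)" using d by (simp add: ln_mult)
    moreover have "ln (f \<nu> y) \<le> ln (c / s ^ M)" using f_le[of y] pos[of y] by simp
    moreover have "0 \<le> (norm y)\<^sup>2 / s" using params by simp
    ultimately have "\<bar>ln (f \<nu> y)\<bar> \<le> \<bar>ln d\<bar> + \<bar>ln (c / s ^ M)\<bar> + 1/s * (norm y)\<^sup>2" by simp
    also have "\<dots> \<le> (\<bar>ln d\<bar> + \<bar>ln (c / s ^ M)\<bar>) * (1 + (norm y)\<^sup>2) + 1/s * (1 + (norm y)\<^sup>2)"
    proof (rule add_mono)
      show "\<bar>ln d\<bar> + \<bar>ln (c / s ^ M)\<bar> \<le> (\<bar>ln d\<bar> + \<bar>ln (c / s ^ M)\<bar>) * (1 + (norm y)\<^sup>2)"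
        by (simp add: algebra_simps)
    qed (use params in \<open>auto intro: divide_right_mono\<close>)
    finally show ?thesis by (simp add: algebra_simps)
  qed
  with pos show ?thesis using params by (intro exI[of _ ?C]) auto
qed

lemma f_pos: "f \<nu> y > 0" using f_bounds by blast

lemma nn_integral_f: "(\<integral>\<^sup>+y. f \<nu> y \<partial>lborel) = 1"
proof -
  interpret P: pair_sigma_finite \<nu> "lborel :: 'b measure" ..
  have "(\<integral>\<^sup>+y. f \<nu> y \<partial>lborel) = (\<integral>\<^sup>+y. \<integral>\<^sup>+x. p x y \<partial>\<nu> \<partial>lborel)" by (simp add: nn_integral_p_input)
  also have "\<dots> = (\<integral>\<^sup>+x. \<integral>\<^sup>+y. p x y \<partial>lborel \<partial>\<nu>)" by (rule P.Fubini') measurable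
  also have "\<dots> = (\<integral>\<^sup>+x. 1 \<partial>\<nu>)"
    by (intro nn_integral_cong, subst nn_integral_eq_integral[OF integrable_p]) (auto simp: integral_p less_imp_le p_pos)
  finally show ?thesis using emeasure_space_1 by simp
qed

lemma integrable_f: "integrable lborel (f \<nu>)" and integral_f: "(\<integral>y. f \<nu> y \<partial>lborel) = 1"
proof -
  show "integrable lborel (f \<nu>)"
    by (rule integrableI_nn_integral_finite[of _ _ 1]) (auto simp: nn_integral_f f_pos less_imp_le)
  show "(\<integral>y. f \<nu> y \<partial>lborel) = 1"
    by (subst integral_eq_nn_integral) (auto simp: nn_integral_f f_pos less_imp_le)
qed

text \<open>Both logarithms grow at most quadratically, so each part is integrable by itself and the
  quotient may be split. The quadratic bound on \<open>J\<close> makes it integrable under inputs of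
  finite power.\<close>

lemma J_integrable: "integrable lborel (\<lambda>y. p x y * ln (p x y / f \<nu> y))"
  and J_split: "J \<nu> x = (\<integral>y. p x y * ln (p x y) \<partial>lborel) - (\<integral>y. p x y * ln (f \<nu> y) \<partial>lborel)"
  and J_le: "\<exists>C\<ge>0. \<forall>x. \<bar>J \<nu> x\<bar> \<le> C * (1 + (norm x)\<^sup>2)"
proof -
  obtain C where C: "C \<ge> 0" "\<And>y. \<bar>ln (f \<nu> y)\<bar> \<le> C * (1 + (norm y)\<^sup>2)" using f_bounds by blast
  have 1: "integrable lborel (\<lambda>y. p x y * ln (p x y))" for x
  proof (rule integrable_p_times)
    fix y :: 'b
    have "B * (1 + (norm x)\<^sup>2 + (norm y)\<^sup>2) \<le> B * ((1 + (norm x)\<^sup>2) * (1 + (norm y)\<^sup>2))"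
      using B_pos by (intro mult_left_mono) (auto simp: algebra_simps)
    then show "\<bar>ln (p x y)\<bar> \<le> (B * (1 + (norm x)\<^sup>2)) * (1 + (norm y)\<^sup>2)"
      using ln_p_bound[of x y] by (simp add: mult.assoc)
  qed simp
  have 2: "integrable lborel (\<lambda>y. p x y * ln (f \<nu> y))" for x
    by (rule integrable_p_times(1)) (use C in auto)
  have eq: "p x y * ln (p x y / f \<nu> y) = p x y * ln (p x y) - p x y * ln (f \<nu> y)" for x y
    using p_pos[of x y] f_pos[of y] by (simp add: ln_div algebra_simps)
  show "integrable lborel (\<lambda>y. p x y * ln (p x y / f \<nu> y))" unfolding eq using 1 2 by auto
  show sp: "J \<nu> x = (\<integral>y. p x y * ln (p x y) \<partial>lborel) - (\<integral>y. p x y * ln (f \<nu> y) \<partial>lborel)" for x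
    unfolding J_def eq using 1 2 by simp
  have b: "\<bar>J \<nu> x\<bar> \<le> (B + C) * (1 + V) * (1 + (norm x)\<^sup>2) + B * (norm x)\<^sup>2" for x
  proof -
    let ?h = "\<lambda>y. (B * (norm x)\<^sup>2) * p x y + (B + C) * (p x y + p x y * (norm y)\<^sup>2)"
    have h: "integrable lborel ?h" using integrable_p integrable_p_norm2 by auto
    have "\<bar>J \<nu> x\<bar> \<le> (\<integral>y. ?h y \<partial>lborel)"
      unfolding J_def
    proof (rule integral_abs_bound[THEN order_trans], rule integral_mono)
      show "integrable lborel (\<lambda>y. \<bar>p x y * ln (p x y / f \<nu> y)\<bar>)"
        unfolding eq using 1 2 by auto
      fix y
      have "\<bar>p x y * ln (p x y / f \<nu> y)\<bar> = p x y * \<bar>ln (p x y) - ln (f \<nu> y)\<bar>"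
        unfolding eq using p_pos[of x y] by (simp add: abs_mult flip: right_diff_distrib)
      also have "\<dots> \<le> p x y * (B * (1 + (norm x)\<^sup>2 + (norm y)\<^sup>2) + C * (1 + (norm y)\<^sup>2))"
        using ln_p_bound[of x y] C(2)[of y] p_pos[of x y] by (intro mult_left_mono) auto
      also have "\<dots> = ?h y" by (simp add: algebra_simps)
      finally show "\<bar>p x y * ln (p x y / f \<nu> y)\<bar> \<le> ?h y" .
    qed (rule h)
    also have "\<dots> = B * (norm x)\<^sup>2 + (B + C) * (1 + (\<integral>y. p x y * (norm y)\<^sup>2 \<partial>lborel))"
      using integrable_p integrable_p_norm2 by (simp add: integral_p)
    also have "\<dots> \<le> B * (norm x)\<^sup>2 + (B + C) * (1 + V * (1 + (norm x)\<^sup>2))"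
      using C(1) B_pos by (intro mult_left_mono add_left_mono integral_p_norm2) auto
    also have "\<dots> \<le> B * (norm x)\<^sup>2 + (B + C) * ((1 + V) * (1 + (norm x)\<^sup>2))"
      using C(1) B_pos V_pos by (intro add_left_mono mult_left_mono) (auto simp: algebra_simps)
    finally show ?thesis by (simp add: mult.assoc)
  qed
  let ?C = "(B + C) * (1 + V) + B"
  have "\<bar>J \<nu> x\<bar> \<le> ?C * (1 + (norm x)\<^sup>2)" for x
    using b[of x] B_pos by (simp add: algebra_simps)
  then show "\<exists>C\<ge>0. \<forall>x. \<bar>J \<nu> x\<bar> \<le> C * (1 + (norm x)\<^sup>2)"
    using C(1) B_pos V_pos by (intro exI[of _ ?C]) auto
qed

lemma J_measurable [measurable]: "J \<nu> \<in> borel_measurable borel"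
  unfolding J_def by measurable

text \<open>Gibbs' inequality: \<open>ln u \<le> u - 1\<close> pointwise, and both densities
  integrate to one.\<close>

lemma J_nonneg: "J \<nu> x \<ge> 0"
proof -
  have "(\<integral>y. p x y - f \<nu> y \<partial>lborel) \<le> J \<nu> x"
    unfolding J_def
  proof (rule integral_mono[OF _ J_integrable])
    fix y
    have "ln (f \<nu> y / p x y) \<le> f \<nu> y / p x y - 1"
      using f_pos[of y] p_pos[of x y] by (intro ln_le_minus_one) auto
    then have "1 - f \<nu> y / p x y \<le> ln (p x y / f \<nu> y)"
      using f_pos[of y] p_pos[of x y] by (simp add: ln_div)
    from mult_left_mono[OF this less_imp_le[OF p_pos[of x y]]]
    show "p x y - f \<nu> y \<le> p x y * ln (p x y / f \<nu> y)"
      using p_pos[of x y] by (simp add: algebra_simps)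
  qed (use integrable_p integrable_f in auto)
  then show ?thesis using integrable_p[of x] integrable_f by (simp add: integral_p integral_f)
qed

end


section \<open>Inputs of bounded power and first-order optimality\<close>

definition input :: "real \<Rightarrow> 'a measure \<Rightarrow> bool" where
  "input A \<mu> \<longleftrightarrow> \<mu> \<in> space (prob_algebra borel) \<and> integrable \<mu> (\<lambda>x. (norm x)\<^sup>2) \<and> (\<integral>x. (norm x)\<^sup>2 \<partial>\<mu>) \<le> A"

lemma inputD:
  assumes "input A \<mu>"
  shows "\<mu> \<in> space (prob_algebra borel)" "integrable \<mu> (\<lambda>x. (norm x)\<^sup>2)" "(\<integral>x. (norm x)\<^sup>2 \<partial>\<mu>) \<le> A"
  using assms by (auto simp: input_def)

lemma J_integrable_input:
  assumes \<mu>: "input A \<mu>" and \<nu>: "\<nu> \<in> space (prob_algebra borel)"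
  shows "integrable \<mu> (J \<nu>)"
proof -
  interpret prob_space \<mu> using prob_algebra_borelD[OF inputD(1)[OF \<mu>]] by simp
  have m: "J \<nu> \<in> borel_measurable \<mu>"
    using J_measurable[OF \<nu>] measurable_cong_sets[OF sets_nu[OF inputD(1)[OF \<mu>]] refl] by auto
  obtain C where C: "\<And>x. \<bar>J \<nu> x\<bar> \<le> C * (1 + (norm x)\<^sup>2)" using J_le[OF \<nu>] by blast
  show ?thesis
  proof (rule Bochner_Integration.integrable_bound[OF _ m])
    show "integrable \<mu> (\<lambda>x. C * (1 + (norm x)\<^sup>2))" using inputD(2)[OF \<mu>] by simp
    have "norm (J \<nu> x) \<le> norm (C * (1 + (norm x)\<^sup>2))" for x
      using order_trans[OF C abs_ge_self] by (simp only: real_norm_def)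
    then show "AE x in \<mu>. norm (J \<nu> x) \<le> norm (C * (1 + (norm x)\<^sup>2))" by simp
  qed
qed

text \<open>The right side minus the left is the relative entropy of \<open>f \<mu>\<close> with
  respect to \<open>f \<nu>\<close>, nonnegative by Gibbs' inequality. Fubini rewrites it as a mean
  under \<open>\<mu>\<close> of \<open>J \<nu> x - J \<mu> x\<close>.\<close>

lemma golden_formula:
  assumes \<mu>: "input A \<mu>" and \<nu>: "\<nu> \<in> space (prob_algebra borel)"
  shows "(\<integral>x. J \<mu> x \<partial>\<mu>) \<le> (\<integral>x. J \<nu> x \<partial>\<mu>)"
proof -
  note \<mu>' = inputD(1)[OF \<mu>]
  interpret prob_space \<mu> using prob_algebra_borelD[OF \<mu>'] by simp
  note [measurable_cong] = sets_nu[OF \<mu>']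
  note [measurable] = f_measurable[OF \<mu>'] f_measurable[OF \<nu>]
  interpret P: pair_sigma_finite \<mu> "lborel :: 'b measure" ..
  define g where "g y = ln (f \<mu> y) - ln (f \<nu> y)" for y
  have [measurable]: "g \<in> borel_measurable borel" unfolding g_def by measurable
  note meas = measurable_p_times[OF \<open>g \<in> borel_measurable borel\<close> sets_nu[OF \<mu>']]
  obtain C D where C: "\<And>y. \<bar>ln (f \<mu> y)\<bar> \<le> C * (1 + (norm y)\<^sup>2)"
    and D: "\<And>y. \<bar>ln (f \<nu> y)\<bar> \<le> D * (1 + (norm y)\<^sup>2)"
    using f_bounds[OF \<mu>'] f_bounds[OF \<nu>] by blast
  have g: "\<bar>g y\<bar> \<le> (C + D) * (1 + (norm y)\<^sup>2)" for y
    using C[of y] D[of y] unfolding g_def distrib_right by linarith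
  note pg = integrable_p_times[of g, OF _ g, simplified]
  have int: "integrable (\<mu> \<Otimes>\<^sub>M lborel) (\<lambda>(x, y). p x y * g y)"
  proof (rule P.Fubini_integrable)
    show "integrable \<mu> (\<lambda>x. \<integral>y. norm (case (x, y) of (x, y) \<Rightarrow> p x y * g y) \<partial>lborel)"
    proof (rule Bochner_Integration.integrable_bound)
      show "(\<lambda>x. \<integral>y. norm (case (x, y) of (x, y) \<Rightarrow> p x y * g y) \<partial>lborel) \<in> borel_measurable \<mu>"
        using meas by simp
      show "integrable \<mu> (\<lambda>x. (C + D) * (1 + V) * (1 + (norm x)\<^sup>2))" using inputD(2)[OF \<mu>] by simp
    qed (auto intro!: order_trans[OF pg(2) abs_ge_self])
  qed (use meas pg(1) in auto)
  have "0 = (\<integral>y. f \<mu> y - f \<nu> y \<partial>lborel)"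
    using integrable_f[OF \<mu>'] integrable_f[OF \<nu>] by (simp add: integral_f[OF \<mu>'] integral_f[OF \<nu>])
  also have "\<dots> \<le> (\<integral>y. \<integral>x. p x y * g y \<partial>\<mu> \<partial>lborel)"
  proof (rule integral_mono)
    show "integrable lborel (\<lambda>y. \<integral>x. p x y * g y \<partial>\<mu>)" using P.integrable_snd[OF int] .
    fix y
    have "ln (f \<nu> y / f \<mu> y) \<le> f \<nu> y / f \<mu> y - 1"
      using f_pos[OF \<mu>'] f_pos[OF \<nu>] by (intro ln_le_minus_one) auto
    then have "1 - f \<nu> y / f \<mu> y \<le> g y"
      unfolding g_def using f_pos[OF \<mu>', of y] f_pos[OF \<nu>, of y] by (simp add: ln_div)
    from mult_left_mono[OF this less_imp_le[OF f_pos[OF \<mu>']], of y]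
    have "f \<mu> y - f \<nu> y \<le> f \<mu> y * g y" using f_pos[OF \<mu>', of y] by (simp add: algebra_simps)
    then show "f \<mu> y - f \<nu> y \<le> (\<integral>x. p x y * g y \<partial>\<mu>)" by (simp add: f_def)
  qed (use integrable_f[OF \<mu>'] integrable_f[OF \<nu>] in auto)
  also have "\<dots> = (\<integral>x. \<integral>y. p x y * g y \<partial>lborel \<partial>\<mu>)" by (rule P.Fubini_integral[OF int])
  also have "\<dots> = (\<integral>x. J \<nu> x - J \<mu> x \<partial>\<mu>)"
  proof (rule Bochner_Integration.integral_cong)
    fix x
    have "integrable lborel (\<lambda>y. p x y * ln (f \<mu> y))" "integrable lborel (\<lambda>y. p x y * ln (f \<nu> y))"
      using integrable_p_times(1)[OF _ C] integrable_p_times(1)[OF _ D] by auto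
    then show "(\<integral>y. p x y * g y \<partial>lborel) = J \<nu> x - J \<mu> x"
      unfolding J_split[OF \<mu>'] J_split[OF \<nu>] g_def by (simp add: right_diff_distrib)
  qed simp
  also have "\<dots> = (\<integral>x. J \<nu> x \<partial>\<mu>) - (\<integral>x. J \<mu> x \<partial>\<mu>)"
    using J_integrable_input[OF \<mu> \<mu>'] J_integrable_input[OF \<mu> \<nu>] by simp
  finally show ?thesis by simp
qed

lemma return_in_prob_algebra: "return borel (x::'a) \<in> space (prob_algebra borel)"
  by (simp add: space_prob_algebra prob_space_return)

text \<open>In \<open>golden_formula\<close> any fixed reference input yields a bound that depends
  on the power alone; the point mass at the origin serves. The bound is what gives the real-valued
  \<open>Sup\<close> in the capacity its meaning.\<close>

lemma mutual_information_bounded: "\<exists>K. \<forall>\<mu>. input A \<mu> \<longrightarrow> (\<integral>x. J \<mu> x \<partial>\<mu>) \<le> K"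
proof -
  let ?\<nu> = "return borel (0::'a)"
  obtain C where C: "C \<ge> 0" "\<And>x. \<bar>J ?\<nu> x\<bar> \<le> C * (1 + (norm x)\<^sup>2)"
    using J_le[OF return_in_prob_algebra] by blast
  have "(\<integral>x. J \<mu> x \<partial>\<mu>) \<le> C * (1 + A)" if \<mu>: "input A \<mu>" for \<mu>
  proof -
    interpret prob_space \<mu> using prob_algebra_borelD[OF inputD(1)[OF \<mu>]] by simp
    have "(\<integral>x. J \<mu> x \<partial>\<mu>) \<le> (\<integral>x. J ?\<nu> x \<partial>\<mu>)" by (rule golden_formula[OF \<mu> return_in_prob_algebra])
    also have "\<dots> \<le> (\<integral>x. C * (1 + (norm x)\<^sup>2) \<partial>\<mu>)"
      using C inputD(2)[OF \<mu>]
      by (intro integral_mono J_integrable_input[OF \<mu> return_in_prob_algebra]) (auto intro: order_trans[OF abs_ge_self])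
    also have "\<dots> = C * (1 + (\<integral>x. (norm x)\<^sup>2 \<partial>\<mu>))" using inputD(2)[OF \<mu>] prob_space by simp
    also have "\<dots> \<le> C * (1 + A)" using C inputD(3)[OF \<mu>] by (intro mult_left_mono) auto
    finally show ?thesis .
  qed
  then show ?thesis by blast
qed

lemma f_mix:
  assumes "0 \<le> \<theta>" "\<theta> \<le> 1" "\<mu> \<in> space (prob_algebra borel)" "\<nu> \<in> space (prob_algebra borel)"
  shows "f (mix \<theta> \<mu> \<nu>) y = (1 - \<theta>) * f \<mu> y + \<theta> * f \<nu> y"
  unfolding f_def
  by (intro has_bochner_integral_integral_eq has_bochner_integral_mix[OF assms] integrable_p_input assms)
    (auto simp: p_pos less_imp_le)

lemma input_mix:
  assumes "0 \<le> \<theta>" "\<theta> \<le> 1" "\<mu> \<in> space (prob_algebra borel)" "\<nu> \<in> space (prob_algebra borel)"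
    and "integrable \<mu> (\<lambda>x. (norm x)\<^sup>2)" "integrable \<nu> (\<lambda>x. (norm x)\<^sup>2)"
    and "(1 - \<theta>) * (\<integral>x. (norm x)\<^sup>2 \<partial>\<mu>) + \<theta> * (\<integral>x. (norm x)\<^sup>2 \<partial>\<nu>) \<le> A"
  shows "input A (mix \<theta> \<mu> \<nu>)"
  using has_bochner_integral_mix[OF assms(1-4) _ assms(5,6)] assms(7) mix_in_prob_algebra[OF assms(1-4)]
  by (auto simp: input_def has_bochner_integral_iff)

text \<open>Necessary condition for optimality in the direction \<open>\<mu>1\<close>. The domination hypothesis bounds the
  logarithm of the perturbed density by a multiple of \<open>\<theta>\<close>, so no limit of integrals is needed.\<close>

lemma kuhn_tucker:
  assumes \<mu>0: "input A \<mu>0" and opt: "\<And>\<mu>. input A \<mu> \<Longrightarrow> (\<integral>x. J \<mu> x \<partial>\<mu>) \<le> (\<integral>x. J \<mu>0 x \<partial>\<mu>0)"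
    and \<mu>1: "input A \<mu>1" and L: "\<And>y. f \<mu>1 y \<le> L * f \<mu>0 y"
  shows "(\<integral>x. J \<mu>0 x \<partial>\<mu>1) \<le> (\<integral>x. J \<mu>0 x \<partial>\<mu>0)"
proof -
  note p0 = inputD(1)[OF \<mu>0] and p1 = inputD(1)[OF \<mu>1]
  interpret \<mu>1: prob_space \<mu>1 using prob_algebra_borelD[OF p1] by simp
  have Lpos: "L > 0"
    using L[of 0] f_pos[OF p0, of 0] f_pos[OF p1, of 0] by (smt (verit) mult_nonneg_nonneg mult_le_0_iff)
  have "(\<integral>x. J \<mu>0 x \<partial>\<mu>1) \<le> (\<integral>x. J \<mu>0 x \<partial>\<mu>0) + \<theta> * L" if \<theta>: "0 < \<theta>" "\<theta> < 1" for \<theta>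
  proof -
    let ?m = "mix \<theta> \<mu>0 \<mu>1"
    have \<theta>': "0 \<le> \<theta>" "\<theta> \<le> 1" using \<theta> by auto
    have m: "input A ?m"
    proof (rule input_mix[OF \<theta>' p0 p1 inputD(2)[OF \<mu>0] inputD(2)[OF \<mu>1]])
      have "(1 - \<theta>) * (\<integral>x. (norm x)\<^sup>2 \<partial>\<mu>0) + \<theta> * (\<integral>x. (norm x)\<^sup>2 \<partial>\<mu>1) \<le> (1 - \<theta>) * A + \<theta> * A"
        using \<theta> inputD(3)[OF \<mu>0] inputD(3)[OF \<mu>1] by (intro add_mono mult_left_mono) auto
      then show "(1 - \<theta>) * (\<integral>x. (norm x)\<^sup>2 \<partial>\<mu>0) + \<theta> * (\<integral>x. (norm x)\<^sup>2 \<partial>\<mu>1) \<le> A" by (simp add: algebra_simps)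
    qed
    note pm = inputD(1)[OF m]
    have Jm: "J \<mu>0 x - \<theta> * L \<le> J ?m x" for x
    proof -
      have "J \<mu>0 x - \<theta> * L = (\<integral>y. p x y * ln (p x y / f \<mu>0 y) - \<theta> * L * p x y \<partial>lborel)"
        using J_integrable[OF p0, of x] integrable_p[of x] by (simp add: J_def integral_p)
      also have "\<dots> \<le> J ?m x"
        unfolding J_def
      proof (rule integral_mono[OF _ J_integrable[OF pm]])
        show "integrable lborel (\<lambda>y. p x y * ln (p x y / f \<mu>0 y) - \<theta> * L * p x y)"
          using J_integrable[OF p0, of x] integrable_p[of x] by simp
        fix y
        note fp = f_pos[OF p0, of y] f_pos[OF pm, of y] p_pos[of x y]
        have "f ?m y \<le> (1 - \<theta>) * f \<mu>0 y + \<theta> * (L * f \<mu>0 y)"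
          unfolding f_mix[OF \<theta>' p0 p1] using \<theta> L by (intro add_left_mono mult_left_mono) auto
        also have "\<dots> \<le> (1 + \<theta> * L) * f \<mu>0 y" using fp \<theta> by (simp add: algebra_simps)
        finally have "ln (f ?m y) \<le> ln ((1 + \<theta> * L) * f \<mu>0 y)"
          using fp by simp
        also have "\<dots> = ln (1 + \<theta> * L) + ln (f \<mu>0 y)" using fp \<theta> Lpos by (intro ln_mult_pos) (auto intro: add_pos_nonneg)
        also have "ln (1 + \<theta> * L) \<le> \<theta> * L" using \<theta> Lpos by (intro ln_add_one_self_le_self) auto
        finally have "ln (p x y / f \<mu>0 y) - \<theta> * L \<le> ln (p x y / f ?m y)" using fp by (simp add: ln_div)
        from mult_left_mono[OF this less_imp_le[OF fp(3)]]
        show "p x y * ln (p x y / f \<mu>0 y) - \<theta> * L * p x y \<le> p x y * ln (p x y / f ?m y)"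
          by (simp add: algebra_simps)
      qed
      finally show ?thesis .
    qed
    \<comment> \<open>On \<open>\<mu>0\<close> the golden formula compares the two divergences
      without loss. The error \<open>\<theta> * L\<close> therefore enters only with weight
      \<theta>, and after division by \<theta> it still tends to zero.\<close>
    have "(1 - \<theta>) * (\<integral>x. J \<mu>0 x \<partial>\<mu>0) + \<theta> * ((\<integral>x. J \<mu>0 x \<partial>\<mu>1) - \<theta> * L)
        \<le> (1 - \<theta>) * (\<integral>x. J ?m x \<partial>\<mu>0) + \<theta> * (\<integral>x. J ?m x \<partial>\<mu>1)"
    proof (intro add_mono mult_left_mono)
      show "(\<integral>x. J \<mu>0 x \<partial>\<mu>0) \<le> (\<integral>x. J ?m x \<partial>\<mu>0)" by (rule golden_formula[OF \<mu>0 pm])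
      have "(\<integral>x. J \<mu>0 x \<partial>\<mu>1) - \<theta> * L = (\<integral>x. J \<mu>0 x - \<theta> * L \<partial>\<mu>1)"
        using J_integrable_input[OF \<mu>1 p0] \<mu>1.prob_space by simp
      also have "\<dots> \<le> (\<integral>x. J ?m x \<partial>\<mu>1)"
        using J_integrable_input[OF \<mu>1 p0] J_integrable_input[OF \<mu>1 pm] Jm by (intro integral_mono) auto
      finally show "(\<integral>x. J \<mu>0 x \<partial>\<mu>1) - \<theta> * L \<le> (\<integral>x. J ?m x \<partial>\<mu>1)" .
    qed (use \<theta> in auto)
    also have "\<dots> = (\<integral>x. J ?m x \<partial>?m)"
      by (rule has_bochner_integral_integral_eq[symmetric], rule has_bochner_integral_mix[OF \<theta>' p0 p1])
        (auto intro: J_nonneg pm J_integrable_input \<mu>0 \<mu>1)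
    also have "\<dots> \<le> (\<integral>x. J \<mu>0 x \<partial>\<mu>0)" by (rule opt[OF m])
    finally have "\<theta> * (\<integral>x. J \<mu>0 x \<partial>\<mu>1) \<le> \<theta> * ((\<integral>x. J \<mu>0 x \<partial>\<mu>0) + \<theta> * L)" by (simp add: algebra_simps)
    then show ?thesis using \<theta> by simp
  qed
  note * = this
  show ?thesis
  proof (rule field_le_epsilon)
    fix e :: real assume e: "e > 0"
    let ?t = "min (1/2) (e / L)"
    have "?t * L \<le> e / L * L" using Lpos by (intro mult_right_mono) auto
    moreover have "0 < ?t" "?t < 1" using e Lpos by auto
    ultimately show "(\<integral>x. J \<mu>0 x \<partial>\<mu>1) \<le> (\<integral>x. J \<mu>0 x \<partial>\<mu>0) + e"
      using *[of ?t] Lpos by (auto simp del: min_less_iff_disj)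
  qed
qed

text \<open>The variational bound for relative entropy, tested on \<open>L\<close> times the indicator of \<open>E\<close>.\<close>

lemma J_lower:
  assumes \<nu>: "\<nu> \<in> space (prob_algebra borel)" and L: "L \<ge> 0" and E: "E \<in> sets borel"
  shows "L * (\<integral>y. indicator E y * p x y \<partial>lborel) - (exp L - 1) * (\<integral>y. indicator E y * f \<nu> y \<partial>lborel) \<le> J \<nu> x"
proof -
  let ?P = "\<lambda>y. indicator E y * p x y" and ?F = "\<lambda>y. indicator E y * f \<nu> y"
  have P: "integrable lborel ?P" and F: "integrable lborel ?F"
    using integrable_real_mult_indicator[OF _ integrable_p, of E] integrable_real_mult_indicator[OF _ integrable_f[OF \<nu>], of E] E
    by (auto simp: mult.commute)
  have "L * (\<integral>y. ?P y \<partial>lborel) - (exp L - 1) * (\<integral>y. ?F y \<partial>lborel)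
      = (\<integral>y. L * ?P y + p x y - (f \<nu> y + (exp L - 1) * ?F y) \<partial>lborel)"
    using P F integrable_p[of x] integrable_f[OF \<nu>] by (simp add: integral_p integral_f[OF \<nu>])
  also have "\<dots> \<le> J \<nu> x"
    unfolding J_def
  proof (rule integral_mono[OF _ J_integrable[OF \<nu>]])
    show "integrable lborel (\<lambda>y. L * ?P y + p x y - (f \<nu> y + (exp L - 1) * ?F y))"
      using P F integrable_p[of x] integrable_f[OF \<nu>] by auto
    fix y
    define g where "g = L * indicator E y"
    note pos = f_pos[OF \<nu>, of y] p_pos[of x y]
    \<comment> \<open>Gibbs' inequality against the tilted density \<open>f \<nu> y * exp g\<close>,
      whose excess over \<open>f \<nu> y\<close> lives on \<open>E\<close>.\<close>
    have "ln (f \<nu> y * exp g / p x y) \<le> f \<nu> y * exp g / p x y - 1"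
      using pos by (intro ln_le_minus_one) auto
    then have "g + 1 - f \<nu> y * exp g / p x y \<le> ln (p x y / f \<nu> y)"
      using pos by (simp add: ln_div ln_mult)
    from mult_left_mono[OF this less_imp_le[OF pos(2)]]
    have "p x y * g + p x y - f \<nu> y * exp g \<le> p x y * ln (p x y / f \<nu> y)"
      using pos by (simp add: algebra_simps)
    then show "L * ?P y + p x y - (f \<nu> y + (exp L - 1) * ?F y) \<le> p x y * ln (p x y / f \<nu> y)"
      by (auto simp: g_def algebra_simps split: split_indicator)
  qed
  finally show ?thesis .
qed

text \<open>Inputs far out put half of their output mass on a region of tiny probability under \<open>f \<nu>\<close>.\<close>

lemma J_unbounded:
  assumes \<nu>: "\<nu> \<in> space (prob_algebra borel)"
  shows "\<exists>z. J \<nu> z > K"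
proof -
  \<comment> \<open>Half of \<open>L\<close> minus a penalty of at most one still exceeds
    \<open>K\<close>.\<close>
  define L where "L = 2 * \<bar>K\<bar> + 4"
  note [measurable] = f_measurable[OF \<nu>]
  have "(\<lambda>n. \<integral>y. indicator (- cball 0 (real n)) y * f \<nu> y \<partial>lborel) \<longlonglongrightarrow> (\<integral>y. 0 \<partial>(lborel :: 'b measure))"
  proof (rule integral_dominated_convergence[where w="f \<nu>"])
    have "(\<lambda>n. indicator (- cball 0 (real n)) y * f \<nu> y) \<longlonglongrightarrow> 0" for y :: 'b
    proof (rule tendsto_eventually)
      obtain N where "norm y \<le> real N" using real_arch_simple by blast
      then show "\<forall>\<^sub>F n in sequentially. indicator (- cball 0 (real n)) y * f \<nu> y = 0"
        by (intro eventually_sequentiallyI[of N]) (auto simp: indicator_def)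
    qed
    then show "AE y in lborel. (\<lambda>n. indicator (- cball 0 (real n)) y * f \<nu> y) \<longlonglongrightarrow> 0" by simp
  qed (use integrable_f[OF \<nu>] f_pos[OF \<nu>] in \<open>auto simp: indicator_def less_imp_le\<close>)
  \<comment> \<open>The threshold \<open>exp (- L)\<close> cancels the factor
    \<open>exp L - 1\<close> in \<open>J_lower\<close>, keeping the penalty below one.\<close>
  then have "\<forall>\<^sub>F n in sequentially. (\<integral>y. indicator (- cball 0 (real n)) y * f \<nu> y \<partial>lborel) < exp (- L)"
    by (intro order_tendstoD(2)) auto
  then obtain n where n: "(\<integral>y. indicator (- cball 0 (real n)) y * f \<nu> y \<partial>lborel) < exp (- L)"
    using eventually_happens'[OF sequentially_bot] by blast
  let ?E = "- cball (0::'b) (real n)"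
  define v where "v = measure lborel (cball (0::'b) (real n))"
  have v: "v \<ge> 0" unfolding v_def by simp
  \<comment> \<open>\<open>w\<close> is the prescribed value of
    \<open>s + l * (norm z)\<^sup>2\<close>: at least \<open>s\<close> so that \<open>z\<close>
    exists, at least \<open>2 * c * v\<close> so that the ball receives at most half of the mass,
    and at least one so that \<open>w \<le> w ^ M\<close>.\<close>
  define w where "w = max s (2 * c * v + 1)"
  have w: "w \<ge> s" "w \<ge> 2 * c * v" "w \<ge> 1" "w > 0"
    using params mult_nonneg_nonneg[of "2 * c" v] v unfolding w_def by linarith+
  obtain z :: 'a where z: "norm z = sqrt ((w - s) / l)"
    using vector_choose_size[of "sqrt ((w - s) / l)"] w params by auto
  then have wz: "s + l * (norm z)\<^sup>2 = w" using w params by simp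
  have p_small: "p z y \<le> c / w" for y
  proof -
    have "p z y \<le> c * exp (- ((norm y)\<^sup>2 / (s + k * (norm z)\<^sup>2))) / w ^ M" using p_upper[of z y] by (simp only: wz)
    also have "\<dots> \<le> c * 1 / w"
      using params w alpha_pos[of z] by (intro frac_le mult_left_mono) (auto intro!: self_le_power)
    finally show ?thesis by simp
  qed
  have fin: "emeasure lborel (cball (0::'b) (real n)) < \<infinity>" by (rule emeasure_lborel_cball_finite)
  have I: "integrable lborel (\<lambda>y::'b. indicator (cball 0 (real n)) y * (c / w))"
    by (rule integrable_mult_left) (use fin in auto)
  have IP: "integrable lborel (\<lambda>y. indicator (cball 0 (real n)) y * p z y)"
    using integrable_real_mult_indicator[OF _ integrable_p, of "cball 0 (real n)"] by (simp add: mult.commute)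
  have "(\<integral>y. indicator (cball 0 (real n)) y * p z y \<partial>lborel) \<le> (\<integral>y. indicator (cball (0::'b) (real n)) y * (c / w) \<partial>lborel)"
    by (intro integral_mono I IP) (auto simp: p_small split: split_indicator)
  also have "\<dots> = v * (c / w)" unfolding v_def by simp
  also have "\<dots> \<le> 1 / 2" using w by (simp add: field_simps)
  finally have "(\<integral>y. p z y - indicator (cball 0 (real n)) y * p z y \<partial>lborel) \<ge> 1 / 2"
    using IP integrable_p[of z] by (simp add: integral_p)
  also have "(\<lambda>y. p z y - indicator (cball 0 (real n)) y * p z y) = (\<lambda>y. indicator ?E y * p z y)"
    by (auto simp: indicator_def)
  finally have half: "(\<integral>y. indicator ?E y * p z y \<partial>lborel) \<ge> 1 / 2" .
  have L: "L \<ge> 0" by (simp add: L_def)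
  have "(exp L - 1) * (\<integral>y. indicator ?E y * f \<nu> y \<partial>lborel) \<le> (exp L - 1) * exp (- L)"
    using n L by (intro mult_left_mono) auto
  also have "\<dots> \<le> 1" by (simp add: algebra_simps flip: exp_add)
  finally have "L * (1 / 2) - 1 \<le> J \<nu> z"
    using J_lower[OF \<nu> L, of ?E z] mult_left_mono[OF half L] by simp
  moreover have "L * (1 / 2) = \<bar>K\<bar> + 2" by (simp add: L_def)
  ultimately have "K < J \<nu> z" by linarith
  then show ?thesis ..
qed

text \<open>If the input has mass arbitrarily far out, then the output density decays more slowly than any
  fixed Gaussian.\<close>

lemma f_heavy_tail:
  assumes \<nu>: "\<nu> \<in> space (prob_algebra borel)"
    and far: "\<And>r. r \<ge> 0 \<Longrightarrow> \<exists>R. measure \<nu> {x. r \<le> norm x \<and> norm x \<le> R} > 0"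
    and r: "r \<ge> 0"
  shows "\<exists>d>0. \<forall>y. d * exp (- ((norm y)\<^sup>2 / (s + l * r\<^sup>2))) \<le> f \<nu> y"
proof -
  obtain R where R: "measure \<nu> {x. r \<le> norm x \<and> norm x \<le> R} > 0" using far[OF r] by blast
  have skR: "s + k * R\<^sup>2 > 0" using params k_pos by (auto intro: add_pos_nonneg)
  define m where "m = measure \<nu> {x. r \<le> norm x \<and> norm x \<le> R}"
  have E: "{x::'a. r \<le> norm x \<and> norm x \<le> R} \<in> sets borel" by measurable
  have *: "m * (c * exp (- ((norm y)\<^sup>2 / (s + l * r\<^sup>2))) / (s + k * R\<^sup>2) ^ M) \<le> f \<nu> y" for y
    unfolding m_def by (rule f_lower[OF \<nu> E _ r]) auto
  have "m * c / (s + k * R\<^sup>2) ^ M * exp (- ((norm y)\<^sup>2 / (s + l * r\<^sup>2))) \<le> f \<nu> y" for y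
    using *[of y] by (simp add: mult.assoc)
  moreover have "m * c / (s + k * R\<^sup>2) ^ M > 0" unfolding m_def using R params skR by simp
  ultimately show ?thesis by blast
qed

section \<open>Slow growth of the divergence and the exchange of mass\<close>

text \<open>The heavy tail bounds \<open>ln (p x y / f \<nu> y)\<close> by a constant plus |y|^2
  over a variance that may be chosen as large as desired, and the conditional mean of |y|^2 is at
  most \<open>V * (1 + (norm x)\<^sup>2)\<close>.\<close>

lemma J_subquadratic:
  assumes \<nu>: "\<nu> \<in> space (prob_algebra borel)"
    and far: "\<And>r. r \<ge> 0 \<Longrightarrow> \<exists>R. measure \<nu> {x. r \<le> norm x \<and> norm x \<le> R} > 0"
    and \<delta>: "\<delta> > 0"
  shows "\<exists>R. \<forall>x. norm x \<ge> R \<longrightarrow> J \<nu> x \<le> \<delta> * (norm x)\<^sup>2"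
proof -
  \<comment> \<open>This radius turns the coefficient of |x|^2 into \<open>\<delta> / 2\<close>; the
    other half of \<delta> absorbs the constants beyond \<open>?R\<close>.\<close>
  define r where "r = sqrt (2 * V / (\<delta> * l))"
  have r: "r \<ge> 0" "l * r\<^sup>2 = 2 * V / \<delta>" using V_pos \<delta> params by (auto simp: r_def)
  have slr: "s + l * r\<^sup>2 > 0" using params by (auto intro: add_pos_nonneg)
  obtain d where d: "d > 0" and lo: "\<And>y. d * exp (- ((norm y)\<^sup>2 / (s + l * r\<^sup>2))) \<le> f \<nu> y"
    using f_heavy_tail[OF \<nu> far r(1)] by blast
  define Q where "Q = ln (c / s ^ M) - ln d"
  have bound: "J \<nu> x \<le> Q + \<delta> / 2 * (1 + (norm x)\<^sup>2)" for x
  proof -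
    have "J \<nu> x \<le> (\<integral>y. Q * p x y + p x y * (norm y)\<^sup>2 / (s + l * r\<^sup>2) \<partial>lborel)"
      unfolding J_def
    proof (rule integral_mono[OF J_integrable[OF \<nu>]])
      show "integrable lborel (\<lambda>y. Q * p x y + p x y * (norm y)\<^sup>2 / (s + l * r\<^sup>2))"
        using integrable_p[of x] integrable_p_norm2[of x] by auto
      fix y
      note pos = f_pos[OF \<nu>, of y] p_pos[of x y]
      have "ln (d * exp (- ((norm y)\<^sup>2 / (s + l * r\<^sup>2)))) \<le> ln (f \<nu> y)"
        using lo[of y] d pos by (subst ln_le_cancel_iff) auto
      then have "ln d - (norm y)\<^sup>2 / (s + l * r\<^sup>2) \<le> ln (f \<nu> y)" using d by (simp add: ln_mult)
      moreover have "ln (p x y) \<le> ln (c / s ^ M)" using p_le[of x y] pos by simp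
      ultimately have "ln (p x y / f \<nu> y) \<le> Q + (norm y)\<^sup>2 / (s + l * r\<^sup>2)"
        unfolding Q_def using pos by (simp add: ln_div)
      from mult_left_mono[OF this less_imp_le[OF pos(2)]]
      show "p x y * ln (p x y / f \<nu> y) \<le> Q * p x y + p x y * (norm y)\<^sup>2 / (s + l * r\<^sup>2)"
        by (simp add: algebra_simps)
    qed
    also have "\<dots> = Q + (\<integral>y. p x y * (norm y)\<^sup>2 \<partial>lborel) / (s + l * r\<^sup>2)"
      using integrable_p[of x] integrable_p_norm2[of x] by (simp add: integral_p)
    also have "\<dots> \<le> Q + V * (1 + (norm x)\<^sup>2) / (s + l * r\<^sup>2)"
      using slr integral_p_norm2[of x] by (intro add_left_mono divide_right_mono) auto
    also have "\<dots> \<le> Q + V * (1 + (norm x)\<^sup>2) / (2 * V / \<delta>)"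
      using slr V_pos \<delta> params r by (intro add_left_mono divide_left_mono) auto
    also have "\<dots> = Q + \<delta> / 2 * (1 + (norm x)\<^sup>2)" using V_pos \<delta> by simp
    finally show ?thesis .
  qed
  let ?R = "sqrt (2 * \<bar>Q\<bar> / \<delta> + 1)"
  show ?thesis
  proof (intro exI[of _ ?R] allI impI)
    fix x :: 'a assume x: "?R \<le> norm x"
    have "?R\<^sup>2 \<le> (norm x)\<^sup>2" using x \<delta> by (intro power_mono) auto
    then have "2 * \<bar>Q\<bar> / \<delta> + 1 \<le> (norm x)\<^sup>2" using \<delta> by simp
    from mult_left_mono[OF this, of "\<delta> / 2"] \<delta> have "\<bar>Q\<bar> + \<delta> / 2 \<le> \<delta> / 2 * (norm x)\<^sup>2"
      by (simp add: algebra_simps)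
    with bound[of x] show "J \<nu> x \<le> \<delta> * (norm x)\<^sup>2" by (simp add: algebra_simps)
  qed
qed

text \<open>The radius \<open>r\<close> is chosen with l r^2 = k |w|^2, so the upper Gaussian of
  \<open>p w\<close> and the lower Gaussian of \<open>f \<nu>\<close> have the same variance and
  their quotient is constant. This supplies the domination hypothesis of
  \<open>kuhn_tucker\<close>.\<close>

lemma p_le_f:
  assumes \<nu>: "\<nu> \<in> space (prob_algebra borel)"
    and far: "\<And>r. r \<ge> 0 \<Longrightarrow> \<exists>R. measure \<nu> {x. r \<le> norm x \<and> norm x \<le> R} > 0"
  shows "\<exists>L. \<forall>y. p w y \<le> L * f \<nu> y"
proof -
  define r where "r = sqrt (k / l) * norm w"
  have r: "r \<ge> 0" "l * r\<^sup>2 = k * (norm w)\<^sup>2" using params k_pos by (auto simp: r_def power_mult_distrib)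
  obtain d where d: "d > 0" and lo: "\<And>y. d * exp (- ((norm y)\<^sup>2 / (s + l * r\<^sup>2))) \<le> f \<nu> y"
    using f_heavy_tail[OF \<nu> far r(1)] by blast
  have "p w y \<le> (c / (s + l * (norm w)\<^sup>2) ^ M / d) * f \<nu> y" for y
  proof -
    have "p w y \<le> (c / (s + l * (norm w)\<^sup>2) ^ M / d) * (d * exp (- ((norm y)\<^sup>2 / (s + l * r\<^sup>2))))"
      using p_upper[of w y] d r by simp
    also have "\<dots> \<le> (c / (s + l * (norm w)\<^sup>2) ^ M / d) * f \<nu> y"
      using params alpha_pos[of w] d by (intro mult_left_mono lo) auto
    finally show ?thesis .
  qed
  then show ?thesis by blast
qed

text \<open>Vanishing mass is claimed on bounded shells because its negation then provides the outer
  radius that the heavy-tail estimate needs.\<close>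

lemma optimal_input_bounded:
  assumes \<mu>0: "input A \<mu>0" and opt: "\<And>\<mu>. input A \<mu> \<Longrightarrow> (\<integral>x. J \<mu> x \<partial>\<mu>) \<le> (\<integral>x. J \<mu>0 x \<partial>\<mu>0)"
  shows "\<exists>r\<ge>0. \<forall>R. measure \<mu>0 {x. r \<le> norm x \<and> norm x \<le> R} = 0"
proof (rule ccontr)
  assume contr: "\<not> ?thesis"
  have far: "\<exists>R. measure \<mu>0 {x. r \<le> norm x \<and> norm x \<le> R} > 0" if "r \<ge> 0" for r
    using contr that by (metis measure_nonneg order_le_less)
  note p0 = inputD(1)[OF \<mu>0]
  interpret prob_space \<mu>0 using prob_algebra_borelD[OF p0] by simp
  note [measurable_cong] = sets_nu[OF p0]
  note [measurable] = J_measurable[OF p0]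
  let ?I = "\<integral>x. J \<mu>0 x \<partial>\<mu>0"
  obtain z where z: "J \<mu>0 z > ?I" using J_unbounded[OF p0] by blast
  define \<eta> where "\<eta> = J \<mu>0 z - ?I"
  \<comment> \<open>Makes \<delta> |z|^2 smaller than the surplus \<eta>; the added one also covers
    \<open>z = 0\<close>.\<close>
  define \<delta> where "\<delta> = \<eta> / ((norm z)\<^sup>2 + 1)"
  have \<eta>: "\<eta> > 0" using z by (simp add: \<eta>_def)
  have z1: "(norm z)\<^sup>2 + 1 > 0" by (auto intro: add_nonneg_pos)
  have \<delta>: "\<delta> > 0" using \<eta> z1 by (simp add: \<delta>_def)
  obtain r0 where r0: "\<And>x. norm x \<ge> r0 \<Longrightarrow> J \<mu>0 x \<le> \<delta> * (norm x)\<^sup>2"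
    using J_subquadratic[OF p0 far \<delta>] by blast
  \<comment> \<open>Radius at least one ensures that the power saved on \<open>E\<close> is no less
    than the mass of \<open>E\<close>, hence positive.\<close>
  define r where "r = max 1 r0"
  obtain R where R: "measure \<mu>0 {x. r \<le> norm x \<and> norm x \<le> R} > 0" using far[of r] unfolding r_def by (metis max.cobounded1 zero_le_one order_trans)
  define E where "E = {x::'a. r \<le> norm x \<and> norm x \<le> R}"
  have E [measurable]: "E \<in> sets borel" unfolding E_def by measurable
  have E': "E \<in> sets \<mu>0" using E by (simp add: sets_nu[OF p0])
  define b where "b = (\<integral>x. indicator E x * (norm x)\<^sup>2 \<partial>\<mu>0)"
  have intb: "integrable \<mu>0 (\<lambda>x. indicator E x * (norm x)\<^sup>2)"
    using integrable_real_mult_indicator[OF E' inputD(2)[OF \<mu>0]] by (simp add: mult.commute)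
  have "measure \<mu>0 E \<le> b"
  proof -
    have "(\<integral>x. indicator E x \<partial>\<mu>0) \<le> b"
      unfolding b_def
    proof (rule integral_mono[OF _ intb])
      fix x show "indicator E x \<le> indicator E x * (norm x)\<^sup>2"
        by (auto simp: E_def r_def split: split_indicator)
    qed (use E' in \<open>auto simp: emeasure_eq_measure\<close>)
    then show ?thesis using E' by simp
  qed
  then have b: "b > 0" using R by (simp add: E_def)
  define \<phi> where "\<phi> x = (if x \<in> E then 0 else x)" for x
  have \<phi> [measurable]: "\<phi> \<in> borel_measurable borel" unfolding \<phi>_def by measurable
  have \<phi>0: "\<phi> \<in> \<mu>0 \<rightarrow>\<^sub>M borel" by (subst measurable_cong_sets[OF sets_nu[OF p0] refl]) (rule \<phi>)
  let ?\<mu>' = "distr \<mu>0 borel \<phi>"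
  have p': "?\<mu>' \<in> space (prob_algebra borel)" using prob_space_distr[OF \<phi>0] by (simp add: space_prob_algebra)
  have norm_\<phi>: "(norm (\<phi> x))\<^sup>2 = (norm x)\<^sup>2 - indicator E x * (norm x)\<^sup>2" for x by (simp add: \<phi>_def)
  \<comment> \<open>The power saved by moving the mass on \<open>E\<close> to the origin pays for mass \<open>\<epsilon>\<close> at \<open>z\<close>.\<close>
  define \<epsilon> where "\<epsilon> = b / ((norm z)\<^sup>2 + b)"
  have zb: "(norm z)\<^sup>2 + b > 0" using b by (auto intro: add_nonneg_pos)
  have \<epsilon>: "0 \<le> \<epsilon>" "\<epsilon> \<le> 1" "0 < \<epsilon>" using b zb by (auto simp: \<epsilon>_def)
  let ?\<delta>z = "return borel z"
  note pz = return_in_prob_algebra[of z]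
  have n2: "has_bochner_integral ?\<mu>' (\<lambda>x. (norm x)\<^sup>2) ((\<integral>x. (norm x)\<^sup>2 \<partial>\<mu>0) - b)"
    unfolding has_bochner_integral_iff
    using inputD(2)[OF \<mu>0] intb \<phi>0
    by (simp add: integrable_distr_eq integral_distr norm_\<phi> b_def)
  have n2z: "has_bochner_integral ?\<delta>z (\<lambda>x. (norm x)\<^sup>2) ((norm z)\<^sup>2)"
    by (rule has_bochner_integral_nn_integral) (auto simp: nn_integral_return)
  let ?\<mu>1 = "mix \<epsilon> ?\<mu>' ?\<delta>z"
  have \<mu>1: "input A ?\<mu>1"
  proof (rule input_mix[OF \<epsilon>(1,2) p' pz])
    have A: "A \<ge> 0" by (rule order_trans[OF Bochner_Integration.integral_nonneg inputD(3)[OF \<mu>0]]) simp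
    \<comment> \<open>With this \<epsilon> the terms in \<open>b\<close> and |z|^2 cancel, leaving
      \<open>(1 - \<epsilon>) * A\<close>.\<close>
    have eb: "\<epsilon> * ((norm z)\<^sup>2 + b) = b" using zb by (simp add: \<epsilon>_def)
    have "(1 - \<epsilon>) * ((\<integral>x. (norm x)\<^sup>2 \<partial>\<mu>0) - b) + \<epsilon> * (norm z)\<^sup>2 \<le> (1 - \<epsilon>) * (A - b) + \<epsilon> * (norm z)\<^sup>2"
      using \<epsilon> inputD(3)[OF \<mu>0] by (intro add_right_mono mult_left_mono) auto
    also have "\<dots> = A - \<epsilon> * A" using eb by (simp add: algebra_simps)
    also have "\<dots> \<le> A" using A \<epsilon> by simp
    finally show "(1 - \<epsilon>) * (\<integral>x. (norm x)\<^sup>2 \<partial>?\<mu>') + \<epsilon> * (\<integral>x. (norm x)\<^sup>2 \<partial>?\<delta>z) \<le> A"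
      using n2 n2z by (simp only: has_bochner_integral_iff)
  qed (use n2 n2z in \<open>auto simp: has_bochner_integral_iff\<close>)
  obtain L0 Lz where L0: "\<And>y. p 0 y \<le> L0 * f \<mu>0 y" and Lz: "\<And>y. p z y \<le> Lz * f \<mu>0 y"
    using p_le_f[OF p0 far] by metis
  \<comment> \<open>Relocation adds at most \<open>p 0 y\<close> to the density, the new atom at
    most \<open>p z y\<close>; \<open>p_le_f\<close> dominates both.\<close>
  have fL: "f ?\<mu>1 y \<le> (1 + L0 + Lz) * f \<mu>0 y" for y
  proof -
    have nn: "0 \<le> f ?\<mu>' y" "0 \<le> p z y" using f_pos[OF p', of y] p_pos[of z y] by auto
    have "f ?\<mu>' y = (\<integral>x. p (\<phi> x) y \<partial>\<mu>0)" unfolding f_def by (rule integral_distr[OF \<phi>0]) simp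
    also have "\<dots> \<le> (\<integral>x. p x y + p 0 y \<partial>\<mu>0)"
    proof (rule integral_mono)
      show "integrable \<mu>0 (\<lambda>x. p (\<phi> x) y)"
        using integrable_p_input[OF p', of y] by (subst (asm) integrable_distr_eq[OF \<phi>0]) auto
      show "integrable \<mu>0 (\<lambda>x. p x y + p 0 y)" using integrable_p_input[OF p0] by auto
      show "p (\<phi> x) y \<le> p x y + p 0 y" for x using p_pos[of x y] p_pos[of 0 y] by (auto simp: \<phi>_def)
    qed
    also have "\<dots> = f \<mu>0 y + p 0 y" using integrable_p_input[OF p0] by (simp add: f_def prob_space)
    finally have 1: "f ?\<mu>' y \<le> f \<mu>0 y + p 0 y" .
    have "f ?\<mu>1 y = (1 - \<epsilon>) * f ?\<mu>' y + \<epsilon> * p z y"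
      using f_mix[OF \<epsilon>(1,2) p' pz, of y] by (simp add: f_def integral_return)
    also have "\<dots> \<le> 1 * f ?\<mu>' y + 1 * p z y"
      using \<epsilon> nn by (intro add_mono mult_right_mono) auto
    finally show ?thesis using 1 L0[of y] Lz[of y] by (simp add: algebra_simps)
  qed
  have J': "integrable ?\<mu>' (J \<mu>0)"
    by (rule J_integrable_input[of "(\<integral>x. (norm x)\<^sup>2 \<partial>?\<mu>')"]) (use p' p0 n2 in \<open>auto simp: input_def has_bochner_integral_iff\<close>)
  have Jz: "integrable ?\<delta>z (J \<mu>0)" 
    using has_bochner_integral_nn_integral[where f="J \<mu>0" and M="?\<delta>z" and x="J \<mu>0 z"] J_nonneg[OF p0]
    by (auto simp: nn_integral_return has_bochner_integral_iff)
  have J0: "integrable \<mu>0 (J \<mu>0)" by (rule J_integrable_input[OF \<mu>0 p0])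
  \<comment> \<open>On \<open>E\<close> the lost divergence is at most \<delta> |x|^2, so the total
    loss is at most \<delta> times the power saved. At the origin nonnegativity of \<open>J\<close>
    suffices.\<close>
  have "?I - \<delta> * b = (\<integral>x. J \<mu>0 x - \<delta> * (indicator E x * (norm x)\<^sup>2) \<partial>\<mu>0)"
    using J0 intb by (simp add: b_def)
  also have "\<dots> \<le> (\<integral>x. J \<mu>0 (\<phi> x) \<partial>\<mu>0)"
  proof (rule integral_mono)
    show "integrable \<mu>0 (\<lambda>x. J \<mu>0 (\<phi> x))"
      using J' by (subst (asm) integrable_distr_eq[OF \<phi>0]) auto
    fix x show "J \<mu>0 x - \<delta> * (indicator E x * (norm x)\<^sup>2) \<le> J \<mu>0 (\<phi> x)"
      using r0[of x] J_nonneg[OF p0, of 0] by (auto simp: \<phi>_def E_def r_def)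
  qed (use J0 intb in auto)
  also have "\<dots> = (\<integral>x. J \<mu>0 x \<partial>?\<mu>')" by (rule integral_distr[OF \<phi>0, symmetric]) simp
  finally have 1: "?I - \<delta> * b \<le> (\<integral>x. J \<mu>0 x \<partial>?\<mu>')" .
  have "(1 - \<epsilon>) * (?I - \<delta> * b) + \<epsilon> * (?I + \<eta>) \<le> (1 - \<epsilon>) * (\<integral>x. J \<mu>0 x \<partial>?\<mu>') + \<epsilon> * J \<mu>0 z"
    using 1 \<epsilon> by (intro add_mono mult_left_mono) (auto simp: \<eta>_def)
  also have "\<dots> = (\<integral>x. J \<mu>0 x \<partial>?\<mu>1)"
    using has_bochner_integral_mix[OF \<epsilon>(1,2) p' pz J_nonneg[OF p0] J' Jz]
    by (simp add: has_bochner_integral_iff integral_return)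
  also have "\<dots> \<le> ?I" by (rule kuhn_tucker[OF \<mu>0 opt \<mu>1 fL])
  finally have "\<epsilon> * \<eta> \<le> (1 - \<epsilon>) * b * \<delta>" by (simp add: algebra_simps)
  \<comment> \<open>The power balance again: it turns the loss bound into \<delta> times the power
    spent at \<open>z\<close>.\<close>
  also have "(1 - \<epsilon>) * b = \<epsilon> * (norm z)\<^sup>2" using zb by (simp add: \<epsilon>_def field_simps)
  finally have "\<eta> \<le> (norm z)\<^sup>2 * \<delta>" using \<epsilon> by (simp add: mult.assoc)
  also have "\<dots> < ((norm z)\<^sup>2 + 1) * \<delta>" using \<delta> by simp
  also have "\<dots> = \<eta>" using z1 by (simp add: \<delta>_def)
  finally show False by simp
qed

end

section \<open>Complex Gaussian integrals\<close>

lemma nn_integral_gauss_real: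
  assumes "p > 0"
  shows "(\<integral>\<^sup>+x. ennreal (exp (- p * x\<^sup>2)) \<partial>lborel) = ennreal (sqrt (pi / p))"
proof -
  define \<sigma> where "\<sigma> = sqrt (1 / (2 * p))"
  have \<sigma>: "\<sigma> > 0" "\<sigma>\<^sup>2 = 1 / (2 * p)" using assms by (auto simp: \<sigma>_def)
  have n: "normal_density 0 \<sigma> x = sqrt (p / pi) * exp (- p * x\<^sup>2)" for x
    using assms unfolding normal_density_def \<sigma>(2) by (simp add: real_sqrt_divide field_simps)
  have "1 = (\<integral>\<^sup>+x. ennreal (normal_density 0 \<sigma> x) \<partial>lborel)"
    using \<sigma>(1) by (subst nn_integral_eq_integral) (auto simp: integrable_normal_density integral_normal_density)
  also have "\<dots> = ennreal (sqrt (p / pi)) * (\<integral>\<^sup>+x. ennreal (exp (- p * x\<^sup>2)) \<partial>lborel)"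
    unfolding n using assms by (subst nn_integral_cmult[symmetric]) (auto simp: ennreal_mult)
  finally have "ennreal (sqrt (pi / p)) * 1 = (ennreal (sqrt (pi / p)) * ennreal (sqrt (p / pi))) * (\<integral>\<^sup>+x. ennreal (exp (- p * x\<^sup>2)) \<partial>lborel)"
    by (simp add: mult.assoc)
  also have "ennreal (sqrt (pi / p)) * ennreal (sqrt (p / pi)) = 1"
    using assms by (simp add: real_sqrt_divide flip: ennreal_mult)
  finally show ?thesis by simp
qed

text \<open>The shift \<open>z\<close> is what completing the square leaves behind; translation
  invariance removes it, and the real and imaginary parts then separate.\<close>

lemma nn_integral_gauss_complex:
  assumes p: "p > 0"
  shows "(\<integral>\<^sup>+w. ennreal (exp (- (p * (cmod (w + z))\<^sup>2))) \<partial>lborel) = ennreal (pi / p)"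
proof -
  have "(\<integral>\<^sup>+w. ennreal (exp (- (p * (cmod (w + z))\<^sup>2))) \<partial>lborel)
      = (\<integral>\<^sup>+w. ennreal (exp (- (p * (cmod w)\<^sup>2))) \<partial>distr lborel borel ((+) z))"
    by (subst nn_integral_distr) (auto simp: add.commute)
  also have "\<dots> = (\<integral>\<^sup>+w. ennreal (exp (- (p * (cmod w)\<^sup>2))) \<partial>lborel)" by (simp only: lborel_distr_plus)
  also have "\<dots> = (\<integral>\<^sup>+w. (\<Prod>b\<in>Basis. ennreal (exp (- p * (w \<bullet> b)\<^sup>2))) \<partial>(lborel :: complex measure))"
    by (intro nn_integral_cong)
      (auto simp: Basis_complex_def cmod_power2 inner_complex_def distrib_left exp_diff exp_minus field_simps simp flip: ennreal_mult)
  also have "\<dots> = (\<Prod>b\<in>(Basis::complex set). \<integral>\<^sup>+x. ennreal (exp (- p * x\<^sup>2)) \<partial>lborel)"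
    by (rule nn_integral_lborel_prod) auto
  also have "\<dots> = ennreal (pi / p)"
    using p unfolding nn_integral_gauss_real[OF p] by (simp add: Basis_complex_def flip: ennreal_mult real_sqrt_mult)
  finally show ?thesis .
qed

section \<open>Lebesgue measure on complex vectors as a product measure\<close>

lemma measurable_vec_lambda_PiM:
  "(\<lambda>g. \<chi> i. g i) \<in> PiM UNIV (\<lambda>_::'m::finite. lborel :: complex measure) \<rightarrow>\<^sub>M borel"
proof (subst borel_measurable_euclidean_space, intro ballI)
  fix b :: "complex^'m" assume "b \<in> Basis"
  then obtain i c where b: "b = axis i c" by (auto simp: Basis_vec_def)
  have "(\<lambda>g. g i \<bullet> c) \<in> borel_measurable (PiM UNIV (\<lambda>_::'m. lborel :: complex measure))"
    by (intro borel_measurable_inner) auto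
  then show "(\<lambda>g. (\<chi> i. g i) \<bullet> b) \<in> borel_measurable (PiM UNIV (\<lambda>_::'m. lborel :: complex measure))"
    by (simp add: b inner_axis)
qed

text \<open>Lebesgue measure is determined by its values on boxes, and a box of vectors is a product
  of boxes in the coordinates. This permits integrating out one complex coordinate at a
  time.\<close>

lemma lborel_vec_eq:
  "(lborel :: (complex^'m::finite) measure) = distr (PiM UNIV (\<lambda>_. lborel)) borel (\<lambda>g. \<chi> i. g i)"
proof (rule lborel_eqI)
  interpret product_sigma_finite "\<lambda>_::'m. lborel :: complex measure" ..
  note m = measurable_vec_lambda_PiM[where ?'m='m]
  fix l u :: "complex^'m" assume lu: "\<And>b. b \<in> Basis \<Longrightarrow> l \<bullet> b \<le> u \<bullet> b"
  have lu': "l $ i \<bullet> b \<le> u $ i \<bullet> b" if "b \<in> Basis" for i b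
    using lu[of "axis i b"] that by (auto simp: inner_axis)
  have "(\<lambda>g. \<chi> i. g i) -` box l u = PiE UNIV (\<lambda>i. box (l $ i) (u $ i))"
    by (auto simp: Basis_vec_def mem_box inner_axis PiE_iff)
  then have "emeasure (distr (PiM UNIV (\<lambda>_. lborel)) borel (\<lambda>g. \<chi> i. g i)) (box l u)
      = emeasure (PiM UNIV (\<lambda>_::'m. lborel)) (PiE UNIV (\<lambda>i. box (l $ i) (u $ i)))"
    by (simp add: emeasure_distr[OF m] space_PiM)
  also have "\<dots> = (\<Prod>i\<in>UNIV. ennreal (\<Prod>b\<in>Basis. (u $ i - l $ i) \<bullet> b))"
    using lu' by (subst emeasure_PiM) auto
  also have "\<dots> = ennreal (\<Prod>i\<in>UNIV. \<Prod>b\<in>Basis. (u $ i - l $ i) \<bullet> b)"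
    using lu' by (intro prod_ennreal) (auto intro!: prod_nonneg simp: inner_diff_left)
  also have "(\<Prod>i\<in>UNIV. \<Prod>b\<in>Basis. (u $ i - l $ i) \<bullet> b) = (\<Prod>b\<in>Basis. (u - l) \<bullet> b)"
  proof -
    have "(\<Prod>b\<in>Basis. (u - l) \<bullet> b) = (\<Prod>b\<in>(\<lambda>(i, b). axis i b) ` (UNIV \<times> Basis). (u - l) \<bullet> b)"
      by (rule prod.cong) (auto simp: Basis_vec_def)
    also have "\<dots> = (\<Prod>(i, b)\<in>UNIV \<times> Basis. (u $ i - l $ i) \<bullet> b)"
      by (subst prod.reindex) (auto simp: inj_on_def axis_eq_axis inner_axis intro!: prod.cong)
    finally show ?thesis by (simp add: prod.cartesian_product)
  qed
  finally show "emeasure (distr (PiM UNIV (\<lambda>_. lborel)) borel (\<lambda>g. \<chi> i. g i)) (box l u) = ennreal (\<Prod>b\<in>Basis. (u - l) \<bullet> b)" .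
qed simp

text \<open>Dimensions are types, so the induction on the dimension runs over subsets \<open>S\<close> of the index type:
  \<open>sub_matrix P S\<close> is the block of \<open>P\<close> on \<open>S\<close>, padded with the identity.\<close>

definition sub_form :: "('m \<Rightarrow> 'm \<Rightarrow> complex) \<Rightarrow> 'm set \<Rightarrow> ('m \<Rightarrow> complex) \<Rightarrow> complex" where
  "sub_form P S y = (\<Sum>i\<in>S. \<Sum>j\<in>S. cnj (y i) * P i j * y j)"

definition sub_matrix :: "('m::finite \<Rightarrow> 'm \<Rightarrow> complex) \<Rightarrow> 'm set \<Rightarrow> complex^'m^'m" where
  "sub_matrix P S = (\<chi> i j. if i \<in> S \<and> j \<in> S then P i j else if i = j then 1 else 0)"

text \<open>The first index \<open>i\<close> is the pivot; \<open>j\<close> and \<open>k\<close> are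
  row and column of the entry.\<close>

definition schur :: "('m \<Rightarrow> 'm \<Rightarrow> complex) \<Rightarrow> 'm \<Rightarrow> 'm \<Rightarrow> 'm \<Rightarrow> complex" where
  "schur P i j k = P j k - P j i * P i k / P i i"

section \<open>Elimination for determinants and Gaussian integrals\<close>

lemma det_row_operations:
  fixes A :: "'a::comm_ring_1^'n^'n"
  assumes "finite T" "i \<notin> T"
  shows "det (\<chi> k. if k \<in> T then row k A + c k *s row i A else row k A) = det A"
  using assms
proof (induction T)
  case empty
  have "(\<chi> k. row k A) = A" by (simp add: row_def vec_eq_iff)
  then show ?case by simp
next
  case (insert t T)
  let ?A = "(\<chi> k. if k \<in> T then row k A + c k *s row i A else row k A)"
  have r: "row t ?A = row t A" "row i ?A = row i A" using insert.hyps insert.prems by (auto simp: row_def)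
  have rk: "row k ?A = (if k \<in> T then row k A + c k *s row i A else row k A)" for k
    by (simp add: row_def)
  have 1: "(\<chi> k. if k \<in> insert t T then row k A + c k *s row i A else row k A)
      = (\<chi> k. if k = t then row t ?A + c t *s row i ?A else row k ?A)"
    unfolding r unfolding rk using insert.hyps by (intro arg_cong[of _ _ vec_lambda]) auto
  have 2: "det (\<chi> k. if k = t then row t ?A + c t *s row i ?A else row k ?A) = det ?A"
    by (rule det_row_operation[of t i ?A "c t"]) (use insert.prems in auto)
  have 3: "det ?A = det A" by (rule insert.IH) (use insert.prems in auto)
  show ?case by (rule trans[OF arg_cong[OF 1, of det] trans[OF 2 3]])
qed

text \<open>One step of Gaussian elimination on both sides. The identity padding makes the cleared
  matrix differ from that of the Schur complement only in its pivot.\<close>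

lemma det_sub_matrix_insert:
  fixes P :: "'m::finite \<Rightarrow> 'm \<Rightarrow> complex"
  assumes i: "i \<notin> S" and Pi: "P i i \<noteq> 0"
  shows "det (sub_matrix P (insert i S)) = P i i * det (sub_matrix (schur P i) S)"
proof -
  let ?A = "sub_matrix P (insert i S)"
  \<comment> \<open>\<open>B\<close> clears column \<open>i\<close> off the pivot; \<open>C\<close>
    clears row \<open>i\<close> by the same operations on the transpose.\<close>
  define B where "B = (\<chi> k. if k \<in> S then row k ?A + (- (P k i / P i i)) *s row i ?A else row k ?A)"
  define C where "C = (\<chi> k. if k \<in> S then row k (transpose B) + (- (P i k / P i i)) *s row i (transpose B) else row k (transpose B))"
  have "det ?A = det C"
    unfolding C_def using i by (subst det_row_operations) (auto simp: det_transpose B_def det_row_operations)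
  also have "C = (\<chi> k. if k = i then P i i *s axis i 1 else row k (transpose (sub_matrix (schur P i) S)))"
    using i Pi
    by (auto simp: vec_eq_iff C_def B_def row_def transpose_def sub_matrix_def schur_def axis_def field_simps)
  also have "det \<dots> = P i i * det (\<chi> k. if k = i then axis i 1 else row k (transpose (sub_matrix (schur P i) S)))"
    by (rule det_row_mul)
  also have "(\<chi> k. if k = i then axis i 1 else row k (transpose (sub_matrix (schur P i) S))) = transpose (sub_matrix (schur P i) S)"
    using i by (auto simp: vec_eq_iff row_def transpose_def sub_matrix_def axis_def)
  finally show ?thesis by (simp add: det_transpose)
qed

text \<open>Completing the square in the coordinate \<open>i\<close>.\<close>

lemma sub_form_insert:
  assumes S: "finite S" "i \<notin> S" and herm: "\<And>j k. P j k = cnj (P k j)" and p: "P i i = of_real p" "p \<noteq> 0"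
  shows "sub_form P (insert i S) y
    = of_real (p * (cmod (y i + (\<Sum>j\<in>S. P i j * y j) / of_real p))\<^sup>2) + sub_form (schur P i) S y"
proof -
  define w where "w = (\<Sum>j\<in>S. P i j * y j)"
  have cw: "cnj w = (\<Sum>j\<in>S. cnj (y j) * P j i)"
    unfolding w_def cnj_sum by (rule sum.cong) (auto simp: mult.commute herm[of _ i])
  have "cnj (y i) * w = (\<Sum>j\<in>S. cnj (y i) * P i j * y j)"
    unfolding w_def sum_distrib_left mult.assoc ..
  moreover have "cnj w * y i = (\<Sum>j\<in>S. cnj (y j) * P j i * y i)"
    unfolding cw sum_distrib_right ..
  ultimately have 1: "sub_form P (insert i S) y
      = cnj (y i) * P i i * y i + cnj (y i) * w + cnj w * y i + sub_form P S y"
    unfolding sub_form_def using S by (simp add: sum.distrib del: complex_cnj_mult)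
  have "cnj w * w / P i i = (\<Sum>j\<in>S. \<Sum>k\<in>S. cnj (y j) * (P j i * P i k / P i i) * y k)"
    unfolding cw unfolding w_def sum_product sum_divide_distrib
    by (intro sum.cong refl) (simp add: ac_simps)
  then have 2: "sub_form (schur P i) S y = sub_form P S y - cnj w * w / P i i"
    unfolding sub_form_def schur_def
    by (simp only: right_diff_distrib left_diff_distrib sum_subtractf)
  have "complex_of_real (p * (cmod (y i + w / of_real p))\<^sup>2)
      = of_real p * (cnj (y i + w / of_real p) * (y i + w / of_real p))"
    by (simp only: of_real_mult complex_norm_square mult.commute)
  also have "\<dots> = cnj (y i) * P i i * y i + cnj (y i) * w + cnj w * y i + cnj w * w / P i i"
    using p by (simp add: field_simps)
  finally have 3: "complex_of_real (p * (cmod (y i + w / of_real p))\<^sup>2)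
      = cnj (y i) * P i i * y i + cnj (y i) * w + cnj w * y i + cnj w * w / P i i" .
  have "u + v = (u + z) + (v - z)" for u v z :: complex by simp
  then show ?thesis unfolding w_def[symmetric] 1 2 3 .
qed

lemma sub_form_measurable:
  "(\<lambda>y. sub_form P S y) \<in> borel_measurable (PiM S (\<lambda>_. lborel))"
proof -
  have 1: "(\<lambda>y. y i) \<in> borel_measurable (PiM S (\<lambda>_. lborel :: complex measure))" if "i \<in> S" for i
    using measurable_component_singleton[OF that, of "\<lambda>_. lborel :: complex measure"] by simp
  have "cnj \<in> borel_measurable borel" by (intro borel_measurable_continuous_onI continuous_intros)
  then have 2: "(\<lambda>y. cnj (y i)) \<in> borel_measurable (PiM S (\<lambda>_. lborel :: complex measure))" if "i \<in> S" for i
    using measurable_compose[OF 1[OF that]] by blast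
  show ?thesis
    unfolding sub_form_def by (intro borel_measurable_sum borel_measurable_times borel_measurable_const 1 2)
qed

text \<open>Determinant and integral obey the same recursion: a pivot \<open>p\<close> multiplies
  the former by \<open>p\<close> and the latter by \<open>pi / p\<close>. Positivity passes to the
  Schur complement, so the next pivot is positive as well.\<close>

lemma nn_integral_gauss_sub_form:
  fixes P :: "'m::finite \<Rightarrow> 'm \<Rightarrow> complex"
  assumes "finite S" "\<And>j k. P j k = cnj (P k j)"
    and "\<And>y. (\<exists>i\<in>S. y i \<noteq> 0) \<Longrightarrow> Re (sub_form P S y) > 0"
  shows "\<exists>d>0. det (sub_matrix P S) = of_real d \<and>
    (\<integral>\<^sup>+y. ennreal (exp (- Re (sub_form P S y))) \<partial>PiM S (\<lambda>_. lborel)) = ennreal (pi ^ card S / d)"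
  using assms
proof (induction S arbitrary: P)
  case empty
  interpret product_sigma_finite "\<lambda>_::'m. lborel :: complex measure" ..
  have "sub_matrix P {} = mat 1" by (simp add: sub_matrix_def mat_def)
  then show ?case by (intro exI[of _ 1]) (simp add: PiM_empty sub_form_def nn_integral_count_space_finite)
next
  case (insert i S)
  interpret product_sigma_finite "\<lambda>_::'m. lborel :: complex measure" ..
  note herm = insert.prems(1) and pd = insert.prems(2)
  define p where "p = Re (P i i)"
  have Pi: "P i i = of_real p" using herm[of i i] by (simp add: p_def complex_eq_iff)
  define e where "e j = (if j = i then 1 else 0 :: complex)" for j
  have e: "e i = 1" "\<And>j. j \<in> S \<Longrightarrow> e j = 0" using insert.hyps by (auto simp: e_def)
  have "sub_form P (insert i S) e = P i i"
    unfolding sub_form_def using insert.hyps e by (simp cong: sum.cong)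
  then have p: "p > 0" using pd[of e] e by (simp add: p_def)
  let ?P = "schur P i"
  note split = sub_form_insert[where P=P, OF insert.hyps(1,2) herm Pi less_imp_neq[OF p, symmetric]]
  have herm': "?P j k = cnj (?P k j)" for j k
    unfolding schur_def using herm[of j k] herm[of j i] herm[of i k] herm[of i i] by (simp add: mult.commute)
  have pd': "Re (sub_form ?P S y) > 0" if y: "\<exists>j\<in>S. y j \<noteq> 0" for y
  proof -
    let ?w = "(\<Sum>j\<in>S. P i j * y j) / of_real p"
    \<comment> \<open>This choice of coordinate \<open>i\<close> annihilates the completed square,
      leaving the Schur form alone.\<close>
    let ?y = "y(i := - ?w)"
    have eq: "(\<Sum>j\<in>S. P i j * ?y j) = (\<Sum>j\<in>S. P i j * y j)" "sub_form ?P S ?y = sub_form ?P S y"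
      unfolding sub_form_def using insert.hyps by (auto intro!: sum.cong)
    have "sub_form P (insert i S) ?y = sub_form ?P S y"
      unfolding split eq by simp
    moreover have "Re (sub_form P (insert i S) ?y) > 0"
      by (rule pd) (use y insert.hyps in \<open>metis fun_upd_apply insert_iff\<close>)
    ultimately show ?thesis by (simp only:)
  qed
  obtain d where d: "d > 0" "det (sub_matrix ?P S) = of_real d"
    "(\<integral>\<^sup>+y. ennreal (exp (- Re (sub_form ?P S y))) \<partial>PiM S (\<lambda>_. lborel)) = ennreal (pi ^ card S / d)"
    using insert.IH[OF herm' pd'] by blast
  have "(\<integral>\<^sup>+y. ennreal (exp (- Re (sub_form P (insert i S) y))) \<partial>PiM (insert i S) (\<lambda>_. lborel))
      = (\<integral>\<^sup>+x. \<integral>\<^sup>+w. ennreal (exp (- Re (sub_form P (insert i S) (x(i := w))))) \<partial>lborel \<partial>PiM S (\<lambda>_. lborel))"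
  proof (rule product_nn_integral_insert[OF insert.hyps(1,2)])
    note [measurable] = sub_form_measurable[of P "insert i S"]
    show "(\<lambda>y. ennreal (exp (- Re (sub_form P (insert i S) y)))) \<in> borel_measurable (PiM (insert i S) (\<lambda>_. lborel))"
      by measurable
  qed
  also have "\<dots> = (\<integral>\<^sup>+x. ennreal (pi / p) * ennreal (exp (- Re (sub_form ?P S x))) \<partial>PiM S (\<lambda>_. lborel))"
  proof (rule nn_integral_cong)
    fix x :: "'m \<Rightarrow> complex"
    have eq: "(\<Sum>j\<in>S. P i j * (x(i := w)) j) = (\<Sum>j\<in>S. P i j * x j)" "sub_form ?P S (x(i := w)) = sub_form ?P S x" for w
      unfolding sub_form_def using insert.hyps by (auto intro!: sum.cong)
    have "(\<integral>\<^sup>+w. ennreal (exp (- Re (sub_form P (insert i S) (x(i := w))))) \<partial>lborel)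
        = (\<integral>\<^sup>+w. ennreal (exp (- (p * (cmod (w + (\<Sum>j\<in>S. P i j * x j) / of_real p))\<^sup>2))) * ennreal (exp (- Re (sub_form ?P S x))) \<partial>lborel)"
      unfolding split eq plus_complex.sel Re_complex_of_real minus_add_distrib exp_add
      by (intro nn_integral_cong) (simp add: ennreal_mult)
    also have "\<dots> = ennreal (pi / p) * ennreal (exp (- Re (sub_form ?P S x)))"
      by (subst nn_integral_multc) (auto simp: nn_integral_gauss_complex[OF p])
    finally show "(\<integral>\<^sup>+w. ennreal (exp (- Re (sub_form P (insert i S) (x(i := w))))) \<partial>lborel)
        = ennreal (pi / p) * ennreal (exp (- Re (sub_form ?P S x)))" .
  qed
  also have "\<dots> = ennreal (pi / p) * ennreal (pi ^ card S / d)"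
  proof -
    note [measurable] = sub_form_measurable[of ?P S]
    show ?thesis by (subst nn_integral_cmult) (auto simp: d)
  qed
  also have "\<dots> = ennreal (pi ^ card (insert i S) / (p * d))"
    using p d insert.hyps by (simp flip: ennreal_mult)
  finally show ?case
    using p d det_sub_matrix_insert[OF insert.hyps(2), of P] Pi by (intro exI[of _ "p * d"]) auto
qed

section \<open>Positive definite matrices\<close>

text \<open>The real inner product is the real part of the Hermitian one. Hermitian forms can
  therefore be written \<open>v \<bullet> (A *v v)\<close> and handled with the real norm.\<close>

lemma inner_complex_vec: "u \<bullet> v = Re (\<Sum>i\<in>UNIV. cnj (u $ i) * v $ i)"
  by (simp add: inner_vec_def inner_complex_def)

lemma cvnorm2_eq: "cvnorm2 x = (norm x)\<^sup>2"
  by (simp add: cvnorm2_def inner_vec_def inner_complex_def cmod_power2 flip: dot_square_norm)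
    (simp add: power2_eq_square)

lemma inner_matrix_vector_mult:
  "u \<bullet> (A *v v) = Re (\<Sum>i\<in>UNIV. \<Sum>j\<in>UNIV. cnj (u $ i) * A $ i $ j * v $ j)"
  unfolding inner_complex_vec matrix_vector_mult_def by (simp add: sum_distrib_left mult.assoc)

lemma pos_def_mat_iff:
  "pos_def_mat A \<longleftrightarrow> hermitian_mat A \<and> (\<forall>v. v \<noteq> 0 \<longrightarrow> v \<bullet> (A *v v) > 0)"
  unfolding pos_def_mat_def inner_matrix_vector_mult by simp

lemma hermitian_mat_iff: "hermitian_mat A \<longleftrightarrow> conj_transpose A = A"
  unfolding hermitian_mat_def conj_transpose_def vec_eq_iff by (auto simp: eq_commute)

lemma norm_diff_square:
  fixes u v :: "'a::real_inner"
  shows "(norm (u - v))\<^sup>2 = (norm u)\<^sup>2 - 2 * (u \<bullet> v) + (norm v)\<^sup>2"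
  unfolding power2_norm_eq_inner by (simp add: inner_diff_left inner_diff_right inner_commute)

lemma conj_transpose_mult: "conj_transpose (A ** B) = conj_transpose B ** conj_transpose A"
  by (simp add: conj_transpose_def matrix_matrix_mult_def vec_eq_iff mult.commute)

lemma conj_transpose_conj_transpose [simp]: "conj_transpose (conj_transpose A) = A"
  by (simp add: conj_transpose_def vec_eq_iff)

lemma conj_transpose_mat: "conj_transpose (mat c) = mat (cnj c)"
  by (auto simp: conj_transpose_def mat_def vec_eq_iff)

lemma conj_transpose_add: "conj_transpose (A + B) = conj_transpose A + conj_transpose B"
  by (simp add: conj_transpose_def vec_eq_iff)

lemma inner_conj_transpose: "u \<bullet> (conj_transpose A *v v) = (A *v u) \<bullet> v"
proof -
  have "(\<Sum>i\<in>UNIV. cnj (u $ i) * (\<Sum>j\<in>UNIV. cnj (A $ j $ i) * v $ j)) = (\<Sum>j\<in>UNIV. cnj (\<Sum>i\<in>UNIV. A $ j $ i * u $ i) * v $ j)"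
    unfolding sum_distrib_left cnj_sum sum_distrib_right by (subst sum.swap) (simp add: ac_simps)
  then show ?thesis unfolding inner_complex_vec by (simp add: matrix_vector_mult_def conj_transpose_def)
qed

lemma mat_vector_mult: "mat c *v v = c *s v"
  by (simp add: matrix_vector_mult_def mat_def vec_eq_iff if_distrib if_distribR sum.delta cong: if_cong)

lemma of_real_smult: "of_real c *s v = c *\<^sub>R (v :: complex^'m)"
  by (simp add: vec_eq_iff) (simp add: scaleR_conv_of_real)

lemma matrix_vector_mult_scaleR_right: "A *v (c *\<^sub>R v) = c *\<^sub>R (A *v (v :: complex^'m))"
  unfolding of_real_smult[symmetric] vector_scalar_commute ..

lemma has_bochner_integral_le:
  fixes g h :: "'a \<Rightarrow> real"
  assumes "has_bochner_integral M g x" "has_bochner_integral M h y" "\<And>w. g w \<le> h w"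
  shows "x \<le> y"
  using assms integral_mono[of M g h] by (auto simp: has_bochner_integral_iff)

text \<open>The case \<open>S = UNIV\<close> of the recursion, carried from coordinate functions to
  vectors. That the same \<open>d\<close> occurs in both claims is what lets integrals bound
  determinants.\<close>

lemma gauss_integral_pos_def:
  fixes A :: "complex^'m::finite^'m"
  assumes "pos_def_mat A"
  shows "\<exists>d>0. det A = of_real d \<and>
    has_bochner_integral lborel (\<lambda>y. exp (- (y \<bullet> (A *v y)))) (pi ^ CARD('m) / d)"
proof -
  have herm: "A $ j $ k = cnj (A $ k $ j)" for j k using assms unfolding pos_def_mat_def hermitian_mat_def by blast
  have form: "Re (sub_form (\<lambda>i j. A $ i $ j) UNIV y) = (\<chi> i. y i) \<bullet> (A *v (\<chi> i. y i))" for y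
    by (simp add: sub_form_def inner_matrix_vector_mult)
  have pd: "Re (sub_form (\<lambda>i j. A $ i $ j) UNIV y) > 0" if "\<exists>i\<in>UNIV. y i \<noteq> 0" for y
    unfolding form using assms that by (auto simp: pos_def_mat_iff vec_eq_iff)
  have A: "sub_matrix (\<lambda>i j. A $ i $ j) UNIV = A" by (simp add: sub_matrix_def vec_eq_iff)
  obtain d where d: "d > 0" "det A = of_real d"
    and I: "(\<integral>\<^sup>+y. ennreal (exp (- ((\<chi> i. y i) \<bullet> (A *v (\<chi> i. y i))))) \<partial>PiM UNIV (\<lambda>_. lborel)) = ennreal (pi ^ CARD('m) / d)"
    using nn_integral_gauss_sub_form[where P="\<lambda>i j. A $ i $ j" and S=UNIV, OF finite herm pd] unfolding form A by blast
  have meas: "(\<lambda>y. exp (- (y \<bullet> (A *v y)))) \<in> borel_measurable borel"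
    unfolding matrix_vector_mult_def by (intro borel_measurable_continuous_onI continuous_intros)
  have "(\<integral>\<^sup>+y. ennreal (exp (- (y \<bullet> (A *v y)))) \<partial>lborel) = ennreal (pi ^ CARD('m) / d)"
    unfolding lborel_vec_eq I[symmetric] using meas
    by (subst nn_integral_distr) (auto intro: measurable_vec_lambda_PiM)
  then show ?thesis using d meas
    by (intro exI[of _ d]) (auto intro!: has_bochner_integral_nn_integral)
qed

text \<open>The nested quotient in the value matches \<open>gauss_integral\<close> with
  \<open>c = 1 / pi ^ M\<close>.\<close>

lemma gauss_integral_isotropic:
  assumes "\<beta> > 0"
  shows "has_bochner_integral lborel (\<lambda>y::complex^'m::finite. exp (- ((norm y)\<^sup>2 / \<beta>))) (\<beta> ^ CARD('m) / (1 / pi ^ CARD('m)))"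
proof -
  let ?A = "mat (of_real (1 / \<beta>)) :: complex^'m^'m"
  have q: "y \<bullet> (?A *v y) = (norm y)\<^sup>2 / \<beta>" for y
    unfolding mat_vector_mult of_real_smult by (simp add: dot_square_norm)
  have "pos_def_mat ?A" unfolding pos_def_mat_iff q hermitian_mat_iff conj_transpose_mat using assms by simp
  from gauss_integral_pos_def[OF this] obtain d where d: "d > 0" "det ?A = of_real d"
    "has_bochner_integral lborel (\<lambda>y::complex^'m. exp (- ((norm y)\<^sup>2 / \<beta>))) (pi ^ CARD('m) / d)"
    unfolding q by blast
  have "det ?A = of_real ((1 / \<beta>) ^ CARD('m))"
    by (subst det_diagonal) (auto simp: mat_def)
  then have "d = (1 / \<beta>) ^ CARD('m)" using d(2) by (simp only: of_real_eq_iff)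
  with d(3) assms show ?thesis by (simp add: power_divide mult.commute)
qed

section \<open>Inverse and determinant from bounds on the quadratic form\<close>

context
  fixes A :: "complex^'m::finite^'m" and \<alpha> \<beta> :: real
  assumes herm: "hermitian_mat A"
    and lower: "\<And>v. \<alpha> * (norm v)\<^sup>2 \<le> v \<bullet> (A *v v)"
    and upper: "\<And>v. v \<bullet> (A *v v) \<le> \<beta> * (norm v)\<^sup>2"
    and \<alpha>: "\<alpha> > 0"
begin

lemma bounded_form_pos_def: "pos_def_mat A"
  unfolding pos_def_mat_iff using herm \<alpha> lower by (smt (verit) mult_pos_pos zero_less_norm_iff zero_less_power)

lemma bounded_form_det_ne_0: "det A \<noteq> 0"
  using gauss_integral_pos_def[OF bounded_form_pos_def] by auto

lemma matrix_inv_bounded_form: "A ** matrix_inv A = mat 1" "matrix_inv A ** A = mat 1"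
proof -
  have "invertible A" using bounded_form_det_ne_0 by (simp add: invertible_det_nz)
  then have "A ** matrix_inv A = mat 1 \<and> matrix_inv A ** A = mat 1"
    unfolding invertible_def matrix_inv_def by (rule someI_ex)
  then show "A ** matrix_inv A = mat 1" "matrix_inv A ** A = mat 1" by auto
qed

lemma mult_matrix_inv: "A *v (matrix_inv A *v y) = y"
  by (simp add: matrix_vector_mul_assoc matrix_inv_bounded_form)

lemma beta_pos: "\<beta> > 0"
proof -
  obtain v :: "complex^'m" where "norm v = 1" using vector_choose_size[of 1] by auto
  with lower[of v] upper[of v] \<alpha> show ?thesis by simp
qed

text \<open>Diagonalization is avoided: expand the squared norm of \<open>matrix_inv A *v y\<close>
  minus \<open>y\<close> divided by \<alpha>, and use that the form of \<open>A\<close> at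
  \<open>matrix_inv A *v y\<close> is the form of the inverse at \<open>y\<close>.\<close>

lemma matrix_inv_form_upper: "y \<bullet> (matrix_inv A *v y) \<le> (norm y)\<^sup>2 / \<alpha>"
proof -
  let ?v = "matrix_inv A *v y"
  let ?q = "y \<bullet> ?v"
  have q: "?q = ?v \<bullet> (A *v ?v)" by (simp add: mult_matrix_inv inner_commute)
  have "0 \<le> (norm (?v - (1/\<alpha>) *\<^sub>R y))\<^sup>2" by simp
  also have "\<dots> = (norm ?v)\<^sup>2 - 2 * ?q / \<alpha> + (norm y)\<^sup>2 / \<alpha>\<^sup>2"
    using \<alpha> by (simp add: norm_diff_square power_divide inner_commute)
  finally have "2 * ?q / \<alpha> \<le> (norm ?v)\<^sup>2 + (norm y)\<^sup>2 / \<alpha>\<^sup>2" by simp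
  then have "\<alpha> * (2 * ?q / \<alpha>) \<le> \<alpha> * ((norm ?v)\<^sup>2 + (norm y)\<^sup>2 / \<alpha>\<^sup>2)" using \<alpha> by (intro mult_left_mono) auto
  then have "2 * ?q \<le> \<alpha> * (norm ?v)\<^sup>2 + (norm y)\<^sup>2 / \<alpha>" using \<alpha> by (simp add: distrib_left power2_eq_square)
  with lower[of ?v] q show ?thesis by simp
qed

text \<open>The same idea with the square taken in the form of \<open>A\<close> instead of the norm,
  at \<open>matrix_inv A *v y\<close> minus \<open>y\<close> divided by \<beta>.\<close>

lemma matrix_inv_form_lower: "(norm y)\<^sup>2 / \<beta> \<le> y \<bullet> (matrix_inv A *v y)"
proof -
  let ?v = "matrix_inv A *v y"
  let ?u = "?v - (1/\<beta>) *\<^sub>R y"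
  have 1: "?v \<bullet> (A *v y) = (norm y)\<^sup>2"
    using inner_conj_transpose[of ?v A y] herm by (simp add: hermitian_mat_iff mult_matrix_inv dot_square_norm)
  have lin: "A *v ?u = y - (1/\<beta>) *\<^sub>R (A *v y)"
    unfolding of_real_smult[symmetric] matrix_vector_mult_diff_distrib vector_scalar_commute mult_matrix_inv ..
  have "0 \<le> ?u \<bullet> (A *v ?u)" by (rule order_trans[OF _ lower]) (use \<alpha> in auto)
  also have "\<dots> = y \<bullet> ?v - 2 * (norm y)\<^sup>2 / \<beta> + (y \<bullet> (A *v y)) / \<beta>\<^sup>2"
    unfolding lin using 1
    by (simp add: inner_diff_left inner_diff_right dot_square_norm inner_commute power2_eq_square)
  also have "(y \<bullet> (A *v y)) / \<beta>\<^sup>2 \<le> \<beta> * (norm y)\<^sup>2 / \<beta>\<^sup>2" by (intro divide_right_mono upper) simp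
  also have "\<dots> = (norm y)\<^sup>2 / \<beta>" using beta_pos by (simp add: power2_eq_square)
  finally show ?thesis by simp
qed

lemma matrix_inv_pos_def: "pos_def_mat (matrix_inv A)"
proof -
  have "conj_transpose (matrix_inv A) ** A = conj_transpose (A ** matrix_inv A)"
    using herm by (simp add: conj_transpose_mult hermitian_mat_iff)
  also have "\<dots> = mat 1" by (simp add: matrix_inv_bounded_form conj_transpose_mat)
  finally have "conj_transpose (matrix_inv A) ** (A ** matrix_inv A) = matrix_inv A"
    by (simp add: matrix_mul_assoc)
  then have "hermitian_mat (matrix_inv A)" by (simp add: hermitian_mat_iff matrix_inv_bounded_form)
  moreover have "y \<bullet> (matrix_inv A *v y) > 0" if "y \<noteq> 0" for y
    using matrix_inv_form_lower[of y] beta_pos that by (smt (verit) divide_pos_pos zero_less_norm_iff zero_less_power)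
  ultimately show ?thesis by (simp add: pos_def_mat_iff)
qed

lemma gauss_integral_matrix_inv:
  "has_bochner_integral lborel (\<lambda>y. exp (- (y \<bullet> (matrix_inv A *v y)))) (pi ^ CARD('m) * Re (det A))"
  and det_bounded_form: "\<alpha> ^ CARD('m) \<le> Re (det A)" "Re (det A) \<le> \<beta> ^ CARD('m)"
proof -
  obtain d where d: "d > 0" "det (matrix_inv A) = of_real d"
    and I: "has_bochner_integral lborel (\<lambda>y. exp (- (y \<bullet> (matrix_inv A *v y)))) (pi ^ CARD('m) / d)"
    using gauss_integral_pos_def[OF matrix_inv_pos_def] by blast
  \<comment> \<open>The Gaussian integral yields the determinant of the inverse; its reciprocal
    shows that \<open>det A\<close> is real and positive.\<close>
  have "det A * det (matrix_inv A) = 1" by (simp add: matrix_inv_bounded_form flip: det_mul)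
  then have "det A = of_real (1 / d)" using d by (simp add: field_simps)
  then have dA: "Re (det A) = 1 / d" by simp
  show G: "has_bochner_integral lborel (\<lambda>y. exp (- (y \<bullet> (matrix_inv A *v y)))) (pi ^ CARD('m) * Re (det A))"
    using I by (simp add: dA)
  have "\<alpha> ^ CARD('m) / (1 / pi ^ CARD('m)) \<le> pi ^ CARD('m) * Re (det A)"
    by (rule has_bochner_integral_le[OF gauss_integral_isotropic[OF \<alpha>] G]) (use matrix_inv_form_upper in auto)
  then show "\<alpha> ^ CARD('m) \<le> Re (det A)" by simp
  have "pi ^ CARD('m) * Re (det A) \<le> \<beta> ^ CARD('m) / (1 / pi ^ CARD('m))"
    by (rule has_bochner_integral_le[OF G gauss_integral_isotropic[OF beta_pos]]) (use matrix_inv_form_lower in auto)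
  then show "Re (det A) \<le> \<beta> ^ CARD('m)" by simp
qed

end

lemma inner_outer: "Re (trace (B ** outer y)) = y \<bullet> (B *v y)"
  unfolding trace_def matrix_matrix_mult_def outer_def inner_matrix_vector_mult
  by (simp add: ac_simps)

text \<open>The constants are the extrema of the form on the compact unit sphere; homogeneity of
  degree two extends the bounds to all vectors.\<close>

lemma pos_def_mat_bounds:
  fixes A :: "complex^'k::finite^'k"
  assumes "pos_def_mat A"
  shows "\<exists>l k. 0 < l \<and> l \<le> k \<and> (\<forall>w. l * (norm w)\<^sup>2 \<le> w \<bullet> (A *v w) \<and> w \<bullet> (A *v w) \<le> k * (norm w)\<^sup>2)"
proof -
  let ?q = "\<lambda>w. w \<bullet> (A *v w)"
  have cont: "continuous_on (sphere 0 1) ?q"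
    unfolding matrix_vector_mult_def by (intro continuous_intros)
  obtain e :: "complex^'k" where "norm e = 1" using vector_choose_size[of 1] by auto
  then have ne: "sphere (0::complex^'k) 1 \<noteq> {}" by auto
  obtain a where a: "a \<in> sphere 0 1" "\<And>w. w \<in> sphere 0 1 \<Longrightarrow> ?q a \<le> ?q w"
    using continuous_attains_inf[OF compact_sphere ne cont] by blast
  obtain b where b: "b \<in> sphere 0 1" "\<And>w. w \<in> sphere 0 1 \<Longrightarrow> ?q w \<le> ?q b"
    using continuous_attains_sup[OF compact_sphere ne cont] by blast
  have scale: "?q w = ?q (w /\<^sub>R norm w) * (norm w)\<^sup>2" if "w \<noteq> 0" for w
    using that by (simp add: matrix_vector_mult_scaleR_right power2_eq_square field_simps)
  have "a \<noteq> 0" using a(1) by auto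
  then have "0 < ?q a" using assms unfolding pos_def_mat_iff by blast
  moreover have "?q a * (norm w)\<^sup>2 \<le> ?q w \<and> ?q w \<le> ?q b * (norm w)\<^sup>2" for w
  proof (cases "w = 0")
    case False
    then have "w /\<^sub>R norm w \<in> sphere 0 1" by simp
    then show ?thesis unfolding scale[OF False] by (intro conjI mult_right_mono a b) auto
  qed simp
  ultimately show ?thesis using a(2)[OF b(1)] by blast
qed

text \<open>The image of \<open>v\<close> is the Kronecker product of \<open>v\<close> and
  \<open>x\<close>, and norms multiply. Bounds for \<open>\<Sigma>\<close> thereby become bounds for
  the output covariance proportional to |x|^2.\<close>

lemma norm_kron_id_col: "(norm ((kron_id_col x :: complex^'m::finite^('m \<times> 'n::finite)) *v v))\<^sup>2 = (norm x)\<^sup>2 * (norm v)\<^sup>2"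
proof -
  have "((kron_id_col x :: complex^'m^('m \<times> 'n)) *v v) $ p = x $ snd p * v $ fst p" for p
    by (simp add: matrix_vector_mult_def kron_id_col_def if_distribR if_distrib cong: if_cong)
  then have "cvnorm2 ((kron_id_col x :: complex^'m^('m \<times> 'n)) *v v)
      = (\<Sum>p\<in>UNIV \<times> UNIV. (cmod (x $ snd p))\<^sup>2 * (cmod (v $ fst p))\<^sup>2)"
    by (simp add: cvnorm2_def norm_mult power_mult_distrib)
  also have "\<dots> = cvnorm2 x * cvnorm2 v"
    unfolding cvnorm2_def sum_product by (subst sum.swap) (simp add: sum.cartesian_product case_prod_beta)
  finally show ?thesis by (simp add: cvnorm2_eq)
qed

lemma out_cov_form:
  "v \<bullet> (out_cov s2 \<Sigma> x *v v) = s2 * (norm v)\<^sup>2 + (kron_id_col x *v v) \<bullet> (\<Sigma> *v (kron_id_col x *v v))"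
  unfolding out_cov_def matrix_vector_mult_add_rdistrib mat_vector_mult of_real_smult
    matrix_vector_mul_assoc[symmetric] inner_add_right inner_conj_transpose
  by (simp add: dot_square_norm)

lemma hermitian_out_cov: "hermitian_mat \<Sigma> \<Longrightarrow> hermitian_mat (out_cov s2 \<Sigma> x)"
  unfolding hermitian_mat_iff out_cov_def
  by (simp add: conj_transpose_add conj_transpose_mat conj_transpose_mult matrix_mul_assoc)

lemma chan_dens_eq:
  "chan_dens s2 (\<Sigma> :: complex^('m::finite \<times> 'n::finite)^('m \<times> 'n)) x y
    = exp (- (y \<bullet> (matrix_inv (out_cov s2 \<Sigma> x) *v y))) / (pi ^ CARD('m) * Re (det (out_cov s2 \<Sigma> x)))"
  by (simp add: chan_dens_def inner_outer)

lemma continuous_on_det: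
  fixes F :: "'a::topological_space \<Rightarrow> complex^'m::finite^'m"
  assumes "continuous_on S F"
  shows "continuous_on S (\<lambda>w. det (F w))"
  unfolding det_def using assms by (intro continuous_intros) 

lemma continuous_on_matrix_mult:
  fixes F :: "'a::topological_space \<Rightarrow> complex^'m::finite^'k::finite" and G :: "'a \<Rightarrow> complex^'l::finite^'m"
  assumes "continuous_on S F" "continuous_on S G"
  shows "continuous_on S (\<lambda>w. F w ** G w)"
  unfolding matrix_matrix_mult_def using assms by (intro continuous_intros continuous_on_vec_lambda)

lemma continuous_on_out_cov:
  assumes "continuous_on S F"
  shows "continuous_on S (\<lambda>w. out_cov s2 \<Sigma> (F w))"
proof -
  have k: "continuous_on S (\<lambda>w. if fst i = j then F w $ snd i else 0)" for i j
    using assms by (cases "fst i = j") (auto intro!: continuous_intros)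
  have 1: "continuous_on S (\<lambda>w. kron_id_col (F w))"
    unfolding kron_id_col_def by (intro continuous_on_vec_lambda k)
  have 2: "continuous_on S (\<lambda>w. conj_transpose (kron_id_col (F w)))"
    unfolding conj_transpose_def kron_id_col_def vec_lambda_beta
    by (intro continuous_on_vec_lambda continuous_on_cnj k)
  show ?thesis unfolding out_cov_def
    by (intro continuous_on_add continuous_on_const continuous_on_matrix_mult 1 2)
qed

section \<open>The fading channel\<close>

context
  fixes s2 l k :: real and \<Sigma> :: "complex^('m::finite \<times> 'n::finite)^('m \<times> 'n)"
  assumes s2: "s2 > 0" and herm: "hermitian_mat \<Sigma>" and lk: "0 < l" "l \<le> k"
    and \<Sigma>: "\<And>w. l * (norm w)\<^sup>2 \<le> w \<bullet> (\<Sigma> *v w)" "\<And>w. w \<bullet> (\<Sigma> *v w) \<le> k * (norm w)\<^sup>2"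
begin

lemma out_cov_bounds:
  shows "(s2 + l * (norm x)\<^sup>2) * (norm v)\<^sup>2 \<le> v \<bullet> (out_cov s2 \<Sigma> x *v v)"
    and "v \<bullet> (out_cov s2 \<Sigma> x *v v) \<le> (s2 + k * (norm x)\<^sup>2) * (norm v)\<^sup>2"
  using \<Sigma>[of "kron_id_col x *v v"]
  unfolding norm_kron_id_col out_cov_form by (simp_all add: algebra_simps)

lemma out_cov_lower_pos: "s2 + l * (norm (x::complex^'n))\<^sup>2 > 0"
  using s2 lk by (auto intro: add_pos_nonneg)

lemmas out_cov_bounded_form = hermitian_out_cov[OF herm] out_cov_bounds out_cov_lower_pos

lemma det_out_cov: "det (out_cov s2 \<Sigma> x) \<noteq> 0" "Re (det (out_cov s2 \<Sigma> x)) > 0"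
  using bounded_form_det_ne_0[OF out_cov_bounded_form, of x] det_bounded_form(1)[OF out_cov_bounded_form, of x]
    zero_less_power[OF out_cov_lower_pos[of x], of "CARD('m)"]
  by auto

text \<open>The density is jointly continuous. As \<open>matrix_inv\<close> is defined by choice,
  continuity is not visible from it; Cramer's rule writes the product of the inverse with
  \<open>y\<close> as a quotient of determinants.\<close>

lemma chan_dens_measurable:
  "(\<lambda>(x, y). chan_dens s2 \<Sigma> x y) \<in> borel_measurable (borel \<Otimes>\<^sub>M borel)"
proof -
  let ?C = "\<lambda>w :: (complex^'n) \<times> (complex^'m). out_cov s2 \<Sigma> (fst w)"
  define S :: "(complex^'n) \<times> (complex^'m) \<Rightarrow> complex^'m" where
    "S w = (\<chi> k. det (\<chi> i j. if j = k then snd w $ i else ?C w $ i $ j) / det (?C w))" for w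
  have C: "continuous_on UNIV ?C" by (intro continuous_on_out_cov continuous_intros)
  have dC: "continuous_on UNIV (\<lambda>w. det (?C w))" by (rule continuous_on_det[OF C])
  have "continuous_on UNIV (\<lambda>w. if j = k then snd w $ i else ?C w $ i $ j)" for i j k
    using C by (cases "j = k") (auto intro!: continuous_intros)
  then have cS: "continuous_on UNIV S"
    unfolding S_def by (intro continuous_on_vec_lambda continuous_on_divide continuous_on_det dC) (auto simp: det_out_cov)
  have "Re (det (?C w)) \<noteq> 0" for w using det_out_cov(2)[of "fst w"] by linarith
  then have "continuous_on UNIV (\<lambda>w. exp (- (snd w \<bullet> S w)) / (pi ^ CARD('m) * Re (det (?C w))))"
    by (intro continuous_intros cS dC) auto
  moreover have "matrix_inv (?C w) *v snd w = S w" for w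
    unfolding S_def using cramer[OF det_out_cov(1)] mult_matrix_inv[OF out_cov_bounded_form] by blast
  ultimately have "continuous_on UNIV (\<lambda>w. chan_dens s2 \<Sigma> (fst w) (snd w))"
    unfolding chan_dens_eq by simp
  then show ?thesis
    by (simp add: borel_prod case_prod_beta borel_measurable_continuous_onI)
qed

lemma gaussian_channel_chan_dens:
  "gaussian_channel (chan_dens s2 \<Sigma>) s2 l k (1 / pi ^ CARD('m)) CARD('m)"
proof
  fix x :: "complex^'n" and y :: "complex^'m"
  let ?C = "out_cov s2 \<Sigma> x"
  let ?a = "s2 + l * (norm x)\<^sup>2" and ?b = "s2 + k * (norm x)\<^sup>2"
  note form = out_cov_bounded_form[where x=x]
  have d: "?a ^ CARD('m) \<le> Re (det ?C)" "Re (det ?C) \<le> ?b ^ CARD('m)" by (rule det_bounded_form[OF form])+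
  have "has_bochner_integral lborel (\<lambda>y. exp (- (y \<bullet> (matrix_inv ?C *v y))) / (pi ^ CARD('m) * Re (det ?C)))
      ((pi ^ CARD('m) * Re (det ?C)) / (pi ^ CARD('m) * Re (det ?C)))"
    using gauss_integral_matrix_inv[OF form] by (intro has_bochner_integral_divide_zero)
  then show "has_bochner_integral lborel (chan_dens s2 \<Sigma> x) 1"
    unfolding chan_dens_eq using det_out_cov(2)[of x] by simp
  have "exp (- ((norm y)\<^sup>2 / ?a)) / (pi ^ CARD('m) * ?b ^ CARD('m)) \<le> chan_dens s2 \<Sigma> x y"
    unfolding chan_dens_eq using det_out_cov(2)[of x] d matrix_inv_form_upper[OF form, of y]
    by (intro frac_le mult_left_mono) auto
  then show "1 / pi ^ CARD('m) * exp (- ((norm y)\<^sup>2 / ?a)) / ?b ^ CARD('m) \<le> chan_dens s2 \<Sigma> x y" by simp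
  have "chan_dens s2 \<Sigma> x y \<le> exp (- ((norm y)\<^sup>2 / ?b)) / (pi ^ CARD('m) * ?a ^ CARD('m))"
    unfolding chan_dens_eq using out_cov_lower_pos[of x] d matrix_inv_form_lower[OF form, of y]
    by (intro frac_le mult_left_mono) auto
  then show "chan_dens s2 \<Sigma> x y \<le> 1 / pi ^ CARD('m) * exp (- ((norm y)\<^sup>2 / ?b)) / ?a ^ CARD('m)" by simp
next
  show "case_prod (chan_dens s2 \<Sigma>) \<in> borel_measurable (borel \<Otimes>\<^sub>M borel)" by (rule chan_dens_measurable)
next
  fix \<beta> :: real assume "\<beta> > 0"
  then show "has_bochner_integral lborel (\<lambda>y::complex^'m. exp (- ((norm y)\<^sup>2 / \<beta>))) (\<beta> ^ CARD('m) / (1 / pi ^ CARD('m)))"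
    by (rule gauss_integral_isotropic)
qed (use s2 lk in auto)

end

theorem theorem2:
  fixes s2 :: real and \<Sigma> :: "complex^('m::finite \<times> 'n::finite)^('m \<times> 'n)"
    and a :: real and \<mu>0 :: "(complex^'n) measure"
  assumes "s2 > 0"
    and "pos_def_mat \<Sigma>"
    and "a > 0"
    and "admissible a \<mu>0"
    and "mut_info s2 \<Sigma> \<mu>0 = capacity s2 \<Sigma> TYPE('n) a"
  shows "bounded (msupp \<mu>0)"
proof -
  obtain l k where lk: "0 < l" "l \<le> k"
    and b: "\<And>w. l * (norm w)\<^sup>2 \<le> w \<bullet> (\<Sigma> *v w)" "\<And>w. w \<bullet> (\<Sigma> *v w) \<le> k * (norm w)\<^sup>2"
    using pos_def_mat_bounds[OF assms(2)] by blast
  have herm: "hermitian_mat \<Sigma>" using assms(2) by (simp add: pos_def_mat_def)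
  interpret gaussian_channel "chan_dens s2 \<Sigma>" s2 l k "1 / pi ^ CARD('m)" "CARD('m)"
    by (rule gaussian_channel_chan_dens[OF assms(1) herm lk b])
  let ?A = "real CARD('n) * a"
  have mut_info_eq: "mut_info s2 \<Sigma> \<mu> = (\<integral>x. J \<mu> x \<partial>\<mu>)" for \<mu> :: "(complex^'n) measure"
    by (simp add: mut_info_def J_def f_def out_dens_def)
  \<comment> \<open>\<open>admissible\<close> uses a nonnegative extended integral normalized by the
    number of antennas, \<open>input\<close> a Bochner integral of the plain squared norm. Explicit
    integrability in \<open>input\<close> excludes the default value zero of a divergent
    integral.\<close>
  have adm: "admissible a \<mu> \<longleftrightarrow> input ?A \<mu>" for \<mu> :: "(complex^'n) measure"
  proof (cases "\<mu> \<in> space (prob_algebra borel)")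
    case True
    have meas: "(\<lambda>x. (norm x)\<^sup>2) \<in> borel_measurable \<mu>"
      by (subst measurable_cong_sets[OF prob_algebra_borelD(2)[OF True] refl]) measurable
    have "(\<integral>\<^sup>+x. ennreal (cvnorm2 x / real CARD('n)) \<partial>\<mu>) \<le> ennreal a
        \<longleftrightarrow> integrable \<mu> (\<lambda>x. (norm x)\<^sup>2) \<and> (\<integral>x. (norm x)\<^sup>2 \<partial>\<mu>) \<le> ?A" (is "?L \<longleftrightarrow> ?R")
    proof
      assume L: ?L
      have "integrable \<mu> (\<lambda>x. (norm x)\<^sup>2 / real CARD('n))"
        using meas le_less_trans[OF L ennreal_less_top] by (intro integrableI_nonneg) (auto simp: cvnorm2_eq)
      from integrable_mult_right[OF this, of "real CARD('n)"]
      have I: "integrable \<mu> (\<lambda>x. (norm x)\<^sup>2)" by simp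
      have "ennreal (\<integral>x. (norm x)\<^sup>2 / real CARD('n) \<partial>\<mu>) \<le> ennreal a"
        using L I by (subst nn_integral_eq_integral[symmetric]) (auto simp: cvnorm2_eq)
      then have "(\<integral>x. (norm x)\<^sup>2 \<partial>\<mu>) / real CARD('n) \<le> a" using assms(3) by (simp add: ennreal_le_iff)
      with I show ?R by (simp add: field_simps)
    next
      assume R: ?R
      then have "(\<integral>\<^sup>+x. ennreal (cvnorm2 x / real CARD('n)) \<partial>\<mu>) = ennreal (\<integral>x. (norm x)\<^sup>2 / real CARD('n) \<partial>\<mu>)"
        by (subst nn_integral_eq_integral[symmetric]) (auto simp: cvnorm2_eq)
      also have "\<dots> \<le> ennreal a" using R by (intro ennreal_leI) (simp add: field_simps)
      finally show ?L .
    qed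
    with True show ?thesis by (simp add: admissible_def input_def space_prob_algebra)
  qed (auto simp: admissible_def input_def space_prob_algebra)
  have \<mu>0: "input ?A \<mu>0" using assms(4) by (simp add: adm)
  have opt: "(\<integral>x. J \<mu> x \<partial>\<mu>) \<le> (\<integral>x. J \<mu>0 x \<partial>\<mu>0)" if "input ?A \<mu>" for \<mu>
  proof -
    obtain K where "\<And>\<mu>. input ?A \<mu> \<Longrightarrow> (\<integral>x. J \<mu> x \<partial>\<mu>) \<le> K" using mutual_information_bounded by blast
    then have "bdd_above {mut_info s2 \<Sigma> \<mu> | \<mu>. admissible a (\<mu> :: (complex^'n) measure)}"
      by (intro bdd_aboveI[of _ K]) (auto simp: adm mut_info_eq)
    then have "mut_info s2 \<Sigma> \<mu> \<le> capacity s2 \<Sigma> TYPE('n) a"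
      unfolding capacity_def using that by (intro cSup_upper) (auto simp: adm)
    then show ?thesis using assms(5) by (simp add: mut_info_eq)
  qed
  obtain r where r: "r \<ge> 0" "\<And>R. measure \<mu>0 {x. r \<le> norm x \<and> norm x \<le> R} = 0"
    using optimal_input_bounded[OF \<mu>0 opt] by blast
  interpret \<mu>0: prob_space \<mu>0 using assms(4) by (simp add: admissible_def)
  have sets: "sets \<mu>0 = sets borel" using assms(4) by (simp add: admissible_def)
  have "norm x \<le> r + 1" if x: "x \<in> msupp \<mu>0" for x
  proof (rule ccontr)
    \<comment> \<open>Beyond \<open>r + 1\<close> the unit ball around \<open>x\<close> stays
      outside radius \<open>r\<close>, so it lies in a shell of measure zero.\<close>
    assume far: "\<not> norm x \<le> r + 1"
    have "ball x 1 \<subseteq> {z. r \<le> norm z \<and> norm z \<le> norm x + 1}"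
    proof
      fix z assume "z \<in> ball x 1"
      then have "\<bar>norm x - norm z\<bar> < 1"
        using norm_triangle_ineq3[of x z] by (simp add: dist_norm)
      then show "z \<in> {z. r \<le> norm z \<and> norm z \<le> norm x + 1}" using far by auto
    qed
    then have "measure \<mu>0 (ball x 1) \<le> measure \<mu>0 {z. r \<le> norm z \<and> norm z \<le> norm x + 1}"
      by (rule \<mu>0.finite_measure_mono) (simp add: sets)
    then have "emeasure \<mu>0 (ball x 1) = 0"
      using r(2) by (simp add: \<mu>0.emeasure_eq_measure measure_le_0_iff)
    then show False using x by (auto simp: msupp_def dest: spec[of _ 1])
  qed
  then show ?thesis by (auto simp: bounded_iff)
qed

end
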